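(* For every integer $k \ge 2$ there exists a constant $c_k > 0$ such that for every positive integer $m$ there is a $k$-uniform hypergraph $H$ with $m$ edges and no isolated vertices whose $4$-color Ramsey number satisfies \[ r_k(H;4) \ge \mathrm{tw}_k\left(c_k\sqrt{m}\right). \]
   Context: For a $k$-uniform hypergraph $H$ and a positive integer $q$, the $q$-color Ramsey number $r_k(H;q)$ is the minimum integer $N$ such that every coloring of the edges of the complete $k$-uniform hypergraph $K_N^{(k)}$ on $N$ vertices with $q$ colors contains a monochromatic copy of $H$ (as a not necessarily induced subhypergraph). The tower function is defined by $\mathrm{tw}_1(x)=x$ and $\mathrm{tw}_k(x)=2^{\mathrm{tw}_{k-1}(x)}$ for $k\ge 2$. A vertex is isolated if it lies in no edge.
   Formalization: As printed, the bound fails for every k ≥ 4 at m = 1 (for k = 4 a single edge has r = 4 < tw_4(c)); for k ≥ 4 it is therefore proved for all m with c_k√m ≥ 1, i.e. all but finitely many m. For k = 2, 3 it is proved for every positive m. *)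

theory Defs
  imports Complex_Main "HOL-Library.FuncSet" "HOL-Library.Ramsey"
begin

text \<open>A hypergraph is given by its vertex set and its edge set;
  \<^term>\<open>[V]\<^bsup>k\<^esup>\<close> is the set of all \<open>k\<close>-element subsets of \<open>V\<close>.\<close>

definition uniform_hypergraph :: "nat \<Rightarrow> 'a set \<Rightarrow> 'a set set \<Rightarrow> bool" where
  "uniform_hypergraph k V E \<longleftrightarrow> finite V \<and> E \<subseteq> [V]\<^bsup>k\<^esup>"

definition isolated_vertex :: "'a set \<Rightarrow> 'a set set \<Rightarrow> 'a \<Rightarrow> bool" where
  "isolated_vertex V E v \<longleftrightarrow> v \<in> V \<and> (\<forall>e\<in>E. v \<notin> e)"

text \<open>Copies are not required to be induced.\<close>

definition contains_copy :: "'a set \<Rightarrow> 'a set set \<Rightarrow> 'b set \<Rightarrow> 'b set set \<Rightarrow> bool" where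
  "contains_copy V E W F \<longleftrightarrow>
     (\<exists>\<phi>. inj_on \<phi> V \<and> \<phi> ` V \<subseteq> W \<and> (\<forall>e\<in>E. \<phi> ` e \<in> F))"

definition ramsey_arrow :: "nat \<Rightarrow> 'a set \<Rightarrow> 'a set set \<Rightarrow> nat \<Rightarrow> nat \<Rightarrow> bool" where
  "ramsey_arrow k V E q N \<longleftrightarrow>
     (\<forall>f \<in> [{..<N}]\<^bsup>k\<^esup> \<rightarrow> {..<q}. \<exists>i<q.
        contains_copy V E {..<N} {e \<in> [{..<N}]\<^bsup>k\<^esup>. f e = i})"

definition ramsey_number :: "nat \<Rightarrow> 'a set \<Rightarrow> 'a set set \<Rightarrow> nat \<Rightarrow> nat" where
  "ramsey_number k V E q = (LEAST N. ramsey_arrow k V E q N)"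

text \<open>The tower function is only meaningful for indices at least 1.\<close>

fun tower :: "nat \<Rightarrow> real \<Rightarrow> real" where
  "tower (Suc 0) x = x"
| "tower (Suc (Suc k)) x = 2 powr tower (Suc k) x"

text \<open>For \<open>c > 0\<close> the value of \<^term>\<open>tower k (c * sqrt m)\<close> exceeds a constant that depends only on
  \<open>k\<close> (4 for \<open>k = 4\<close>, 16 for \<open>k = 5\<close>, \<open>\<dots>\<close>), however small \<open>c\<close> is. The bound
  \<^term>\<open>real (ramsey_number k V E 4) \<ge> tower k (c * sqrt m)\<close> can therefore not hold for all
  positive \<open>m\<close> when \<open>k \<ge> 4\<close>. For \<open>k = 4\<close> and \<open>m = 1\<close> it fails for every choice of \<open>c\<close> and of the
  hypergraph, as the following lemma shows.\<close>

lemma tower_bound_fails_single_edge: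
  fixes V :: "'a set" and c :: real
  assumes H: "uniform_hypergraph 4 V E" and card: "card E = 1"
    and iso: "\<nexists>v. isolated_vertex V E v" and c: "c > 0"
  shows "real (ramsey_number 4 V E 4) < tower 4 (c * sqrt 1)"
proof -
  obtain e where E: "E = {e}" using card by (auto simp: card_1_singleton_iff)
  have e: "e \<subseteq> V" "finite V" "card e = 4" using H E by (auto simp: uniform_hypergraph_def nsets_def)
  have V: "V = e" using iso e E by (auto simp: isolated_vertex_def)
  obtain \<phi> where \<phi>: "bij_betw \<phi> V {..<4::nat}"
    using e V by (metis card_lessThan finite_lessThan finite_same_card_bij)
  have "ramsey_arrow 4 V E 4 4"
    unfolding ramsey_arrow_def
  proof
    fix f :: "nat set \<Rightarrow> nat" assume f: "f \<in> [{..<4}]\<^bsup>4\<^esup> \<rightarrow> {..<4}"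
    have I: "{..<4} \<in> [{..<4::nat}]\<^bsup>4\<^esup>" by (simp add: nsets_def)
    have "contains_copy V E {..<4} {e \<in> [{..<4}]\<^bsup>4\<^esup>. f e = f {..<4}}"
      unfolding contains_copy_def using \<phi> I V E
      by (intro exI[of _ \<phi>]) (auto simp: bij_betw_def)
    moreover have "f {..<4} < 4" using f I by auto
    ultimately show "\<exists>i<4. contains_copy V E {..<4} {e \<in> [{..<4}]\<^bsup>4\<^esup>. f e = i}" by blast
  qed
  then have "ramsey_number 4 V E 4 \<le> 4" unfolding ramsey_number_def by (rule Least_le)
  moreover have "2 powr (2 powr (2 powr c)) > (2::real) powr (2 powr (2 powr 0))"
    using c by (intro powr_less_mono) auto
  ultimately show ?thesis by (simp add: numeral_eq_Suc)
qed

end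

theory Submission
  imports Defs
begin

text \<open>
  The hypergraph consists of \<open>n\<close> groups of bounded size \<open>g\<close>, its edges are all \<open>k\<close>-sets inside the
  union of two groups, and a matching fills up the number of edges. It has \<open>O(n\<^sup>2)\<close> edges, but a
  4-coloring that avoids it can be stepped up from \<open>k\<close> to \<open>k + 1\<close>: an integer below \<open>2 ^ N\<close> is a leaf of
  the binary tree of depth \<open>N\<close>, and a set of leaves is colored according to the levels at which it
  branches. Every large group contains a long path of the tree along which the other elements of the
  group branch off one by one to the same side. Half of the groups use the same side, and since any two
  of them span a clique, their paths must merge into a single path. So the branching levels of each
  group are a group of a monochromatic copy for the coloring one uniformity lower. From \<open>k = 2\<close> to
  \<open>k = 3\<close> groups of two leaves suffice, and for \<open>k = 2\<close> the hypergraph is a complete graph.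
\<close>

section \<open>Branching levels in ordered binary trees\<close>

text \<open>A clique on \<open>n\<close> vertices has about \<open>n ^ k\<close> edges, which would
  leave only the k-th root of \<open>m\<close> in the tower; keeping just the k-sets inside two
  groups lowers the count to order \<open>n ^ 2\<close>. The price is that nothing is known about
  sets meeting three groups, so every contradiction has to be found inside a pair of groups. A
  second obstacle is that stepping up must not cost colors, or their number would grow with
  \<open>k\<close>. Colors 0 and 1, which the old coloring uses as well, therefore serve as markers:
  0 for sets with at least two elements on each side of the topmost branching, 1 for sets with a
  lone element there that do not form a path to one side. If the paths of two groups fail to merge,
  both kinds occur in one pair, whatever the old coloring is. This needs sets of at least four
  elements, since a triple always has a lone element at its topmost branching. So the step to
  triples records the side as a second bit next to the color of a graph, and these two bits make up
  the four colors.\<close>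

definition descending :: "('a \<Rightarrow> 'a \<Rightarrow> bool) \<Rightarrow> ('a \<Rightarrow> 'a \<Rightarrow> nat) \<Rightarrow> 'a set \<Rightarrow> bool" where
  "descending lt \<delta> e \<longleftrightarrow>
     (\<forall>x\<in>e. \<forall>y\<in>e. \<forall>z\<in>e. lt x y \<longrightarrow> lt y z \<longrightarrow> \<delta> y z < \<delta> x y)"

text \<open>In a binary tree, \<open>p\<close> is the only element of \<open>e\<close> on its side of the topmost branching of \<open>e\<close>.\<close>

definition isolated :: "('a \<Rightarrow> 'a \<Rightarrow> nat) \<Rightarrow> 'a set \<Rightarrow> 'a \<Rightarrow> bool" where
  "isolated \<delta> e p \<longleftrightarrow>
     p \<in> e \<and> (\<forall>q\<in>e. \<forall>x\<in>e. \<forall>y\<in>e. q \<noteq> p \<longrightarrow> x \<noteq> y \<longrightarrow> \<delta> x y \<le> \<delta> p q)"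

definition levels :: "('a \<Rightarrow> 'a \<Rightarrow> nat) \<Rightarrow> 'a set \<Rightarrow> nat set" where
  "levels \<delta> e = {\<delta> x y |x y. x \<in> e \<and> y \<in> e \<and> x \<noteq> y}"

text \<open>The reduction modulo 4 only matters for sets \<open>levels \<delta> e\<close> outside of the domain of \<open>\<chi>\<close>.\<close>

definition step_color ::
  "('a \<Rightarrow> 'a \<Rightarrow> bool) \<Rightarrow> ('a \<Rightarrow> 'a \<Rightarrow> nat) \<Rightarrow> (nat set \<Rightarrow> nat) \<Rightarrow> 'a set \<Rightarrow> nat" where
  "step_color lt \<delta> \<chi> e =
     (if \<nexists>p. isolated \<delta> e p then 0
      else if descending lt \<delta> e \<or> descending (\<lambda>x y. lt y x) \<delta> e then \<chi> (levels \<delta> e) mod 4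
      else 1)"

text \<open>Swapping the order exchanges the two disjuncts in \<open>step_color\<close>, so groups
  whose path goes to the other side can be handled in the reversed tree.\<close>

lemma step_color_converse: "step_color (\<lambda>x y. lt y x) \<delta> \<chi> e = step_color lt \<delta> \<chi> e"
  by (auto simp: step_color_def)

lemma step_color_less: "step_color lt \<delta> \<chi> e < 4"
  by (simp add: step_color_def)

section \<open>Ordered binary trees as ultrametrics\<close>

text \<open>The tree is kept abstract because the reversed order satisfies the same axioms, so that
  one side suffices. \<open>binary\<close> encodes that no node has three children.\<close>

locale ordered_tree =
  fixes lt :: "'a \<Rightarrow> 'a \<Rightarrow> bool" and \<delta> :: "'a \<Rightarrow> 'a \<Rightarrow> nat"
  assumes lt_irrefl: "\<not> lt x x"
    and lt_trans: "lt x y \<Longrightarrow> lt y z \<Longrightarrow> lt x z"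
    and lt_total: "x \<noteq> y \<Longrightarrow> lt x y \<or> lt y x"
    and dist_sym: "\<delta> x y = \<delta> y x"
    and ultra: "lt x y \<Longrightarrow> lt y z \<Longrightarrow> \<delta> x z = max (\<delta> x y) (\<delta> y z)"
    and binary: "lt x y \<Longrightarrow> lt y z \<Longrightarrow> \<delta> x y \<noteq> \<delta> y z"
begin

lemma converse: "ordered_tree (\<lambda>x y. lt y x) \<delta>"
  by unfold_locales (metis lt_irrefl lt_trans lt_total dist_sym ultra binary max.commute)+

lemma lt_neq: "lt x y \<Longrightarrow> x \<noteq> y"
  using lt_irrefl by blast

text \<open>The leaves closer to \<open>x\<close> than \<open>z\<close> is form a subtree, which is
  an interval of the order without \<open>z\<close>; hence all of them see \<open>z\<close> on the
  same side and at the same level.\<close>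

lemma near_left:
  assumes "lt x z" "\<delta> x y < \<delta> x z" "x \<noteq> y"
  shows "lt y z" "\<delta> y z = \<delta> x z"
proof -
  have "lt y z \<and> \<delta> y z = \<delta> x z"
  proof -
    consider "lt y x" | "lt x y" "lt y z" | "lt x z" "lt z y" | "y = z"
      using assms lt_total by metis
    then show ?thesis
    proof cases
      case 1
      then show ?thesis using ultra[of y x z] lt_trans[of y x z] dist_sym[of x y] assms by auto
    next
      case 2
      then show ?thesis using ultra[of x y z] assms by (auto simp: max_def split: if_splits)
    next
      case 3
      then show ?thesis using ultra[of x z y] assms by auto
    qed (use assms in auto)
  qed
  then show "lt y z" "\<delta> y z = \<delta> x z" by auto
qed

lemma near_right:
  assumes "lt x z" "\<delta> z y < \<delta> x z" "z \<noteq> y"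
  shows "lt x y" "\<delta> x y = \<delta> x z"
proof -
  interpret c: ordered_tree "\<lambda>x y. lt y x" \<delta> by (rule converse)
  show "lt x y" "\<delta> x y = \<delta> x z"
    using c.near_left[where x = z and z = x and y = y] assms dist_sym[of x z] dist_sym[of x y] by auto
qed

lemma step_color_balanced:
  assumes "\<And>p. p \<in> e \<Longrightarrow> \<exists>q\<in>e. \<exists>x\<in>e. \<exists>y\<in>e. q \<noteq> p \<and> x \<noteq> y \<and> \<delta> p q < \<delta> x y"
  shows "step_color lt \<delta> \<chi> e = 0"
  using assms unfolding step_color_def isolated_def by (metis not_less)

lemma step_color_bent:
  assumes "isolated \<delta> e p" "\<not> descending lt \<delta> e" "\<not> descending (\<lambda>x y. lt y x) \<delta> e"
  shows "step_color lt \<delta> \<chi> e = 1"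
  using assms unfolding step_color_def by metis

section \<open>Paths with leaves branching off to one side\<close>

text \<open>All leaves after \<open>a i\<close> lie below the other child of the node where
  \<open>a i\<close> branches off. A sequence of \<open>h\<close> leaves thus has
  \<open>h - 1\<close> levels, its last leaf being the end of the path.\<close>

definition descending_seq :: "(nat \<Rightarrow> 'a) \<Rightarrow> nat \<Rightarrow> bool" where
  "descending_seq a h \<longleftrightarrow>
     (\<forall>i j. i < j \<longrightarrow> j < h \<longrightarrow> lt (a i) (a j)) \<and>
     (\<forall>i j l. i < j \<longrightarrow> j < l \<longrightarrow> l < h \<longrightarrow> \<delta> (a j) (a l) < \<delta> (a i) (a j))"

abbreviation level :: "(nat \<Rightarrow> 'a) \<Rightarrow> nat \<Rightarrow> nat" where
  "level a i \<equiv> \<delta> (a i) (a (Suc i))"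

lemma descending_seq_lt: "descending_seq a h \<Longrightarrow> i < j \<Longrightarrow> j < h \<Longrightarrow> lt (a i) (a j)"
  by (simp add: descending_seq_def)

lemma descending_seq_level:
  assumes "descending_seq a h" "i < j" "j < h"
  shows "\<delta> (a i) (a j) = level a i"
proof (cases "j = Suc i")
  case False
  then have "Suc i < j" using assms by simp
  then have "\<delta> (a (Suc i)) (a j) < level a i" "lt (a i) (a (Suc i))" "lt (a (Suc i)) (a j)"
    using assms unfolding descending_seq_def by auto
  then show ?thesis using ultra by fastforce
qed auto

lemma descending_seq_level_less:
  assumes "descending_seq a h" "i < j" "Suc j < h"
  shows "level a j < level a i"
proof -
  have "\<delta> (a j) (a (Suc j)) < \<delta> (a i) (a j)"
    using assms unfolding descending_seq_def by auto
  then show ?thesis using descending_seq_level[of a h i j] assms by auto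
qed

lemma descending_seq_inj:
  assumes "descending_seq a h"
  shows "inj_on a {..<h}"
proof (rule inj_onI)
  fix i j assume "i \<in> {..<h}" "j \<in> {..<h}" "a i = a j"
  then show "i = j"
    using descending_seq_lt[OF assms, of i j] descending_seq_lt[OF assms, of j i] lt_irrefl
    by (metis lessThan_iff nat_neq_iff)
qed

lemma descending_seq_dist_le:
  assumes "descending_seq a h" "s \<le> i" "s \<le> j" "i < h" "j < h" "i \<noteq> j"
  shows "\<delta> (a i) (a j) \<le> level a s"
proof -
  have *: "\<delta> (a i) (a j) \<le> level a s" if "i < j" "s \<le> i" "j < h" for i j
  proof -
    have "\<delta> (a i) (a j) = level a i" using descending_seq_level assms(1) that by blast
    also have "\<dots> \<le> level a s"
      using descending_seq_level_less[OF assms(1), of s i] that by (cases "s = i") auto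
    finally show ?thesis .
  qed
  show ?thesis
    using *[of i j] *[of j i] assms dist_sym by (metis nat_neq_iff)
qed

text \<open>If \<open>b\<close> leaves the path together with \<open>a s\<close>, then these two and later elements of the path have
  color 0, whereas adding \<open>a 0\<close> isolates it and gives a bent set of color 1.\<close>

lemma no_twin:
  assumes k: "k \<ge> 3" and a: "descending_seq a h" and s: "1 \<le> s" "s + k \<le> h"
    and b: "b \<notin> a ` {..<h}"
    and mono: "\<And>e. e \<subseteq> insert b (a ` {..<h}) \<Longrightarrow> card e = Suc k \<Longrightarrow> step_color lt \<delta> \<chi> e = c"
  shows "\<not> \<delta> (a s) b < level a s"
proof
  assume less: "\<delta> (a s) b < level a s"
  note inj = descending_seq_inj[OF a]
  have ab: "a i \<noteq> b" if "i < h" for i using b that by auto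
  have later: "lt b (a j)" "\<delta> b (a j) = level a s" if "s < j" "j < h" for j
    using near_left[of "a s" "a j" b] descending_seq_lt[OF a] descending_seq_level[OF a, of s j]
      less that ab[of s] by auto
  have first: "lt (a 0) (a s)" "\<delta> (a 0) (a s) = level a 0" "level a s < level a 0"
    using descending_seq_lt[OF a, of 0 s] descending_seq_level[OF a, of 0 s]
      descending_seq_level_less[OF a, of 0 s] s k by auto
  have first_b: "lt (a 0) b" "\<delta> (a 0) b = level a 0"
    using near_right[of "a 0" "a s" b] first less ab[of s] s k by auto
  let ?e0 = "insert b (a ` {s..<s+k})"
  have sub0: "{s..<s+k} \<subseteq> {..<h}" using s by auto
  have "card ?e0 = Suc k"
    using b sub0 card_image[OF inj_on_subset[OF inj sub0]] by (subst card_insert_disjoint) auto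
  moreover have "?e0 \<subseteq> insert b (a ` {..<h})" using s by auto
  ultimately have c0: "step_color lt \<delta> \<chi> ?e0 = c" by (intro mono)
  have "step_color lt \<delta> \<chi> ?e0 = 0"
  proof (rule step_color_balanced)
    fix p assume p: "p \<in> ?e0"
    have lv: "a s \<in> ?e0" "a (s+1) \<in> ?e0" "a (s+2) \<in> ?e0" "a s \<noteq> a (s+1)"
      using k s lt_neq[OF descending_seq_lt[OF a, of s "s+1"]] by auto
    consider "p = b" | "p = a s" | i where "p = a i" "s < i" "i < s+k"
      using p by (auto simp: le_less)
    then show "\<exists>q\<in>?e0. \<exists>x\<in>?e0. \<exists>y\<in>?e0. q \<noteq> p \<and> x \<noteq> y \<and> \<delta> p q < \<delta> x y"
    proof cases
      case 1
      then have "\<delta> p (a s) < \<delta> (a s) (a (s+1))" using less dist_sym by (metis add.commute plus_1_eq_Suc)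
      moreover have "a s \<noteq> p" using ab[of s] s k 1 by auto
      ultimately show ?thesis using lv by blast
    next
      case 2
      then have "\<delta> p b < \<delta> (a s) (a (s+1))" using less by simp
      moreover have "b \<noteq> p" using ab[of s] s k 2 by auto
      ultimately show ?thesis using lv by blast
    next
      case 3
      \<comment> \<open>Since \<open>k \<ge> 3\<close>, the set has at least two leaves after
        \<open>a s\<close>; their mutual distances are below \<open>level a s\<close>.\<close>
      define j where "j = (if i = s+1 then s+2 else s+1)"
      have j: "s < j" "j < s + k" "j \<noteq> i" using k by (auto simp: j_def)
      have "\<delta> p (a j) \<le> level a (Suc s)"
        using descending_seq_dist_le[OF a, of "Suc s" i j] 3 j s by auto
      also have "\<dots> < level a s" using descending_seq_level_less[OF a, of s "Suc s"] s k by auto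
      finally have "\<delta> p (a j) < \<delta> (a s) (a (s+1))" by simp
      moreover have "a j \<in> ?e0" "a j \<noteq> p" using j 3 s inj by (auto simp: inj_on_def)
      ultimately show ?thesis using lv by blast
    qed
  qed
  with c0 have "c = 0" by simp
  let ?e1 = "insert b (insert (a 0) (a ` {s..<s+k-1}))"
  have sub1: "insert 0 {s..<s+k-1} \<subseteq> {..<h}" using s k by auto
  have "card (insert (a 0) (a ` {s..<s+k-1})) = k"
    using card_image[OF inj_on_subset[OF inj sub1]] s k by auto
  then have "card ?e1 = Suc k"
    using b sub1 by (subst card_insert_disjoint) auto
  moreover have "?e1 \<subseteq> insert b (a ` {..<h})" using s k by auto
  ultimately have c1: "step_color lt \<delta> \<chi> ?e1 = c" by (intro mono)
  have "step_color lt \<delta> \<chi> ?e1 = 1"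
  proof (rule step_color_bent)
    have d0: "\<delta> (a 0) q = level a 0" if q: "q \<in> ?e1" "q \<noteq> a 0" for q
    proof (cases "q = b")
      case False
      then obtain i where "q = a i" "0 < i" "i < h" using q s by (auto intro!: gr0I)
      then show ?thesis using descending_seq_level[OF a, of 0 i] by simp
    qed (use first_b in auto)
    have d: "\<delta> x y \<le> level a 0" if "x \<in> ?e1" "y \<in> ?e1" "x \<noteq> y" for x y
    proof -
      have "lt (a 0) q" if "q \<in> ?e1" "q \<noteq> a 0" for q
        using that first_b descending_seq_lt[OF a, of 0] s by auto
      then show ?thesis
        using d0 that ultra[of "a 0" x y] ultra[of "a 0" y x] lt_total[of x y] dist_sym
        by (metis max.cobounded2 order_refl)
    qed
    show "isolated \<delta> ?e1 (a 0)"
      unfolding isolated_def using d0 d by auto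
    have in1: "a s \<in> ?e1" "a (Suc s) \<in> ?e1" "b \<in> ?e1" "a 0 \<in> ?e1" using k by auto
    have s1: "lt (a s) (a (Suc s))" "lt b (a (Suc s))" "\<delta> b (a (Suc s)) = level a s"
      using descending_seq_lt[OF a] later[of "Suc s"] s k by auto
    have as_b: "a s \<noteq> b" using ab[of s] s k by auto
    \<comment> \<open>The pair \<open>a s\<close>, \<open>b\<close> is closer together than either
      is to \<open>a (Suc s)\<close> or to \<open>a 0\<close>. The leaf \<open>a (Suc s)\<close> on
      its right refutes one direction, \<open>a 0\<close> on its left the other.\<close>
    show "\<not> descending lt \<delta> ?e1"
    proof
      assume d: "descending lt \<delta> ?e1"
      from lt_total[OF as_b] show False
      proof
        assume "lt (a s) b"
        then have "\<delta> b (a (Suc s)) < \<delta> (a s) b"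
          using d in1 s1 unfolding descending_def by blast
        then show False using s1 less by simp
      next
        assume "lt b (a s)"
        then have "level a s < \<delta> b (a s)"
          using d in1 s1 unfolding descending_def by blast
        then show False using less dist_sym[of b "a s"] by simp
      qed
    qed
    show "\<not> descending (\<lambda>x y. lt y x) \<delta> ?e1"
    proof
      assume d: "descending (\<lambda>x y. lt y x) \<delta> ?e1"
      from lt_total[OF as_b] show False
      proof
        assume "lt (a s) b"
        then have "\<delta> (a s) (a 0) < \<delta> b (a s)"
          using d in1 first unfolding descending_def by blast
        then show False using first less dist_sym[of b "a s"] dist_sym[of "a s" "a 0"] by simp
      next
        assume "lt b (a s)"
        then have "\<delta> b (a 0) < \<delta> (a s) b"
          using d in1 first_b unfolding descending_def by blast
        then show False using first first_b less dist_sym[of b "a 0"] by simp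
      qed
    qed
  qed
  with c1 \<open>c = 0\<close> show False by simp
qed

text \<open>Otherwise the rests of the two paths lie on the two sides of one node: two elements of the first
  with \<open>k - 1\<close> of the second have color 0, \<open>k\<close> of the first with one of the second have color 1.\<close>

lemma no_overtake:
  assumes k: "k \<ge> 3" and a: "descending_seq a h" and b: "descending_seq b h"
    and s: "s + k \<le> h" and j: "j + k \<le> h"
    and disj: "a ` {..<h} \<inter> b ` {..<h} = {}"
    and mono: "\<And>e. e \<subseteq> a ` {..<h} \<union> b ` {..<h} \<Longrightarrow> card e = Suc k \<Longrightarrow>
                 step_color lt \<delta> \<chi> e = c"
    and lt: "lt (a s) (b j)"
  shows "\<not> level a s < \<delta> (a s) (b j)"
proof
  assume less: "level a s < \<delta> (a s) (b j)"
  have ab: "a i \<noteq> b i'" if "i < h" "i' < h" for i i' using disj that by auto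
  have tail: "lt (a r) (b j)" "\<delta> (a r) (b j) = \<delta> (a s) (b j)" if "s \<le> r" "r < h" for r
  proof -
    have "lt (a r) (b j) \<and> \<delta> (a r) (b j) = \<delta> (a s) (b j)"
    proof (cases "r = s")
      case False
      then have "\<delta> (a s) (a r) < \<delta> (a s) (b j)" "a s \<noteq> a r"
        using that less descending_seq_level[OF a, of s r] lt_neq[OF descending_seq_lt[OF a, of s r]]
        by auto
      then show ?thesis using near_left[OF lt] by simp
    qed (use lt in auto)
    then show "lt (a r) (b j)" "\<delta> (a r) (b j) = \<delta> (a s) (b j)" by auto
  qed
  \<comment> \<open>If \<open>b j\<close> branches off its own path above the node where it parts
    from the leaves of \<open>a\<close>, these lie on the side of \<open>b j\<close>, and only the
    leaves after \<open>b j\<close> are opposite. Then \<open>j'\<close> is \<open>Suc j\<close>,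
    which is why only \<open>k - 1\<close> leaves of \<open>b\<close> are guaranteed.\<close>
  obtain j' M where j': "j' + k \<le> Suc h" and M: "level a s < M" "level b j' < M"
    and cross: "\<And>r r'. s \<le> r \<Longrightarrow> r < h \<Longrightarrow> j' \<le> r' \<Longrightarrow> r' < h \<Longrightarrow>
                  lt (a r) (b r') \<and> \<delta> (a r) (b r') = M"
  proof -
    have bj: "lt (b j) (b (Suc j))" using descending_seq_lt[OF b] j k by auto
    have "level b j \<noteq> \<delta> (a s) (b j)" using binary[OF lt bj] by simp
    then consider "level b j < \<delta> (a s) (b j)" | "\<delta> (a s) (b j) < level b j" by linarith
    then show thesis
    proof cases
      case 1
      show thesis
      proof (rule that[of j "\<delta> (a s) (b j)"])
        fix r r' assume r: "s \<le> r" "r < h" "j \<le> r'" "r' < h"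
        show "lt (a r) (b r') \<and> \<delta> (a r) (b r') = \<delta> (a s) (b j)"
        proof (cases "r' = j")
          case False
          then have "\<delta> (b j) (b r') < \<delta> (a r) (b j)" "b j \<noteq> b r'"
            using r 1 tail(2)[of r] descending_seq_level[OF b, of j r']
              lt_neq[OF descending_seq_lt[OF b, of j r']] by auto
          then show ?thesis using near_right[of "a r" "b j" "b r'"] tail[of r] r by auto
        qed (use tail[of r] r in auto)
      qed (use j less 1 in auto)
    next
      case 2
      show thesis
      proof (rule that[of "Suc j" "level b j"])
        show "level b (Suc j) < level b j"
          using descending_seq_level_less[OF b, of j "Suc j"] j k by auto
        fix r r' assume r: "s \<le> r" "r < h" "Suc j \<le> r'" "r' < h"
        have "lt (b j) (b r')" "\<delta> (b j) (b r') = level b j"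
          using r descending_seq_lt[OF b, of j r'] descending_seq_level[OF b, of j r'] by auto
        then show "lt (a r) (b r') \<and> \<delta> (a r) (b r') = level b j"
          using near_left[of "b j" "b r'" "a r"] 2 tail[of r] r dist_sym[of "b j" "a r"]
            ab[of r j] j k by auto
      qed (use j less 2 in auto)
    qed
  qed
  note inja = descending_seq_inj[OF a] and injb = descending_seq_inj[OF b]
  let ?A = "\<lambda>n. a ` {s..<s+n}" and ?B = "\<lambda>n. b ` {j'..<j'+n}"
  have cardA: "card (?A n) = n" if "n \<le> k" for n
    using s that by (subst card_image[OF inj_on_subset[OF inja]]) auto
  have cardB: "card (?B n) = n" if "Suc n \<le> k" for n
    using j' that by (subst card_image[OF inj_on_subset[OF injb]]) auto
  have subA: "?A n \<subseteq> a ` {..<h}" if "n \<le> k" for n using s that by auto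
  have subB: "?B n \<subseteq> b ` {..<h}" if "Suc n \<le> k" for n using j' that by auto
  have c: "step_color lt \<delta> \<chi> (?A n \<union> ?B n') = c" if n: "n \<le> k" "Suc n' \<le> k" "n + n' = Suc k" for n n'
  proof (rule mono)
    have "?A n \<inter> ?B n' = {}" using disj subA[OF n(1)] subB[OF n(2)] by blast
    then show "card (?A n \<union> ?B n') = Suc k"
      using n cardA cardB by (subst card_Un_disjoint) auto
    show "?A n \<union> ?B n' \<subseteq> a ` {..<h} \<union> b ` {..<h}" using subA subB n by blast
  qed
  have dA: "\<delta> (a i) (a i') < M" if "s \<le> i" "s \<le> i'" "i < h" "i' < h" "i \<noteq> i'" for i i'
    using descending_seq_dist_le[OF a] that M by (meson le_less_trans)
  have dB: "\<delta> (b i) (b i') < M" if "j' \<le> i" "j' \<le> i'" "i < h" "i' < h" "i \<noteq> i'" for i i'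
    using descending_seq_dist_le[OF b] that M by (meson le_less_trans)
  have sh: "Suc (Suc s) < h" "s < h" "j' < h" using s j' k by auto
  have "step_color lt \<delta> \<chi> (?A 2 \<union> ?B (k - 1)) = 0"
  proof (rule step_color_balanced)
    fix p assume p: "p \<in> ?A 2 \<union> ?B (k - 1)"
    have top: "a s \<in> ?A 2" "b j' \<in> ?B (k - 1)" "a s \<noteq> b j'" "\<delta> (a s) (b j') = M"
      using k ab cross sh by auto
    from p consider i where "p = a i" "s \<le> i" "i < s + 2"
      | i where "p = b i" "j' \<le> i" "i < j' + (k - 1)" by auto
    then have "\<exists>q\<in>?A 2 \<union> ?B (k - 1). q \<noteq> p \<and> \<delta> p q < M"
    proof cases
      case 1
      define i' where "i' = (if i = s then Suc s else s)"
      have i': "s \<le> i'" "i' < s + 2" "i' \<noteq> i" by (auto simp: i'_def)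
      moreover have "a i' \<noteq> a i" using inja i' 1 sh by (auto dest: inj_onD)
      ultimately show ?thesis using 1 dA[of i i'] sh by auto
    next
      case 2
      define i' where "i' = (if i = j' then Suc j' else j')"
      have i': "j' \<le> i'" "i' < j' + (k - 1)" "i' \<noteq> i" using k by (auto simp: i'_def)
      moreover have "b i' \<noteq> b i" using injb i' 2 j' by (auto dest: inj_onD)
      ultimately show ?thesis using 2 dB[of i i'] j' by auto
    qed
    then show "\<exists>q\<in>?A 2 \<union> ?B (k - 1). \<exists>x\<in>?A 2 \<union> ?B (k - 1). \<exists>y\<in>?A 2 \<union> ?B (k - 1).
        q \<noteq> p \<and> x \<noteq> y \<and> \<delta> p q < \<delta> x y"
      using top by (metis UnI1 UnI2)
  qed
  then have "c = 0" using c[of 2 "k - 1"] k by simp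
  have "step_color lt \<delta> \<chi> (?A k \<union> ?B 1) = 1"
  proof (rule step_color_bent)
    have e: "?A k \<union> ?B 1 = insert (b j') (?A k)" by auto
    show "isolated \<delta> (?A k \<union> ?B 1) (b j')"
      unfolding isolated_def e
    proof (intro conjI ballI impI)
      have eq: "\<delta> (a i) (b j') = M" "\<delta> (b j') (a i) = M" if "i \<in> {s..<s+k}" for i
        using cross[of i j'] that s sh dist_sym by auto
      fix q x y assume q: "q \<in> insert (b j') (?A k)" "q \<noteq> b j'"
        and xy: "x \<in> insert (b j') (?A k)" "y \<in> insert (b j') (?A k)" "x \<noteq> y"
      have "\<delta> (a i) (a i') \<le> M" if "i \<in> {s..<s+k}" "i' \<in> {s..<s+k}" "i \<noteq> i'" for i i'
        using dA[of i i'] that s by auto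
      then have "\<delta> x y \<le> M"
        using xy eq by (auto simp: image_iff) (metis order_refl)+
      then show "\<delta> x y \<le> \<delta> (b j') q" using q eq by auto
    qed simp
    have in1: "a s \<in> ?A k \<union> ?B 1" "a (Suc s) \<in> ?A k \<union> ?B 1" "a (Suc (Suc s)) \<in> ?A k \<union> ?B 1"
      "b j' \<in> ?A k \<union> ?B 1" using k by auto
    have lts: "lt (a s) (a (Suc s))" "lt (a (Suc s)) (a (Suc (Suc s)))"
      using descending_seq_lt[OF a] sh by auto
    show "\<not> descending lt \<delta> (?A k \<union> ?B 1)"
    proof
      assume "descending lt \<delta> (?A k \<union> ?B 1)"
      then have "\<delta> (a (Suc s)) (b j') < level a s"
        using in1 lts cross[of "Suc s" j'] sh unfolding descending_def
        by (meson Suc_lessD le_refl le_Suc_eq)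
      then show False using cross[of "Suc s" j'] sh M by auto
    qed
    show "\<not> descending (\<lambda>x y. lt y x) \<delta> (?A k \<union> ?B 1)"
    proof
      assume "descending (\<lambda>x y. lt y x) \<delta> (?A k \<union> ?B 1)"
      then have "\<delta> (a (Suc s)) (a s) < \<delta> (a (Suc (Suc s))) (a (Suc s))"
        using in1 lts unfolding descending_def by blast
      then show False
        using descending_seq_level_less[OF a, of s "Suc s"] sh dist_sym
        by (metis Suc_lessD lessI not_less_iff_gr_or_eq)
    qed
  qed
  then show False using c[of k 1] k \<open>c = 0\<close> by simp
qed

text \<open>\<open>no_overtake\<close> and \<open>no_twin\<close> exclude that the two leaves branch
  above or below \<open>level a s\<close>. By \<open>binary\<close> this level differs from
  \<open>level b j\<close>, and \<open>no_twin\<close> with exchanged roles forbids the latter to be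
  larger.\<close>

lemma merge_levels:
  assumes k: "k \<ge> 3" and a: "descending_seq a h" and b: "descending_seq b h"
    and s: "1 \<le> s" "s + k \<le> h" and j: "1 \<le> j" "j + k \<le> h"
    and disj: "a ` {..<h} \<inter> b ` {..<h} = {}"
    and mono: "\<And>e. e \<subseteq> a ` {..<h} \<union> b ` {..<h} \<Longrightarrow> card e = Suc k \<Longrightarrow>
                 step_color lt \<delta> \<chi> e = c"
    and lt: "lt (a s) (b j)"
  shows "\<delta> (a s) (b j) = level a s" "level b j < level a s"
proof -
  have in_h: "s < h" "j < h" using s j k by auto
  have "\<not> level a s < \<delta> (a s) (b j)"
    by (rule no_overtake[OF k a b s(2) j(2) disj mono lt])
  moreover have "\<not> \<delta> (a s) (b j) < level a s"
    by (rule no_twin[OF k a s, where \<chi> = \<chi> and c = c]) (use disj in_h in \<open>auto intro!: mono\<close>)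
  ultimately show eq: "\<delta> (a s) (b j) = level a s" by simp
  have "\<not> \<delta> (b j) (a s) < level b j"
    by (rule no_twin[OF k b j, where \<chi> = \<chi> and c = c]) (use disj in_h in \<open>auto intro!: mono\<close>)
  moreover have "\<delta> (a s) (b j) \<noteq> level b j"
    using binary[OF lt descending_seq_lt[OF b, of j "Suc j"]] j k by auto
  ultimately show "level b j < level a s" using eq dist_sym[of "b j" "a s"] by simp
qed

text \<open>The bridge back to the old coloring: a \<open>k\<close>-set of levels is realized by the
  \<open>k\<close> leaves branching off there and one leaf further down the path, and such a set is
  descending. The leaf \<open>w x\<close> depends on \<open>x\<close> because the two groups end in
  different leaves.\<close>

lemma lift_color:
  assumes k: "k \<ge> 1" and X: "finite X" "X \<subseteq> S"
    and w: "\<And>x. x \<in> X \<Longrightarrow> lt x (w x) \<and> w x \<in> S \<and> w x \<notin> X"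
    and chain: "\<And>x y. x \<in> X \<Longrightarrow> y \<in> X \<Longrightarrow> lt x y \<Longrightarrow>
                  \<delta> x y = \<delta> x (w x) \<and> \<delta> y (w y) < \<delta> x (w x)"
    and d: "d \<in> [(\<lambda>x. \<delta> x (w x)) ` X]\<^bsup>k\<^esup>"
  obtains e where "e \<subseteq> S" "card e = Suc k" "step_color lt \<delta> \<chi> e = \<chi> d mod 4"
proof -
  define L where "L x = \<delta> x (w x)" for x
  have "inj_on L X"
    unfolding inj_on_def L_def using chain lt_total by (metis less_irrefl)
  with d obtain Y where Y: "Y \<in> [X]\<^bsup>k\<^esup>" and dY: "d = L ` Y"
    unfolding L_def[symmetric] by (rule nset_image_obtains)
  have YX: "Y \<subseteq> X" and finY: "finite Y" and cardY: "card Y = k" using Y by (auto simp: nsets_def)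
  have "Y \<noteq> {}" using cardY k by auto
  then have "Min (L ` Y) \<in> L ` Y" "Max (L ` Y) \<in> L ` Y" using finY by auto
  then obtain y0 y1 where y01: "y0 \<in> Y" "L y0 = Min (L ` Y)" "y1 \<in> Y" "L y1 = Max (L ` Y)"
    by (metis imageE)
  then have ge: "L y0 \<le> L y" and le: "L y \<le> L y1" if "y \<in> Y" for y
    using that finY by auto
  have chainY: "\<delta> x y = L x \<and> L y < L x" if "x \<in> Y" "y \<in> Y" "lt x y" for x y
    using chain that YX unfolding L_def by blast
  \<comment> \<open>The end is taken for the leaf with the lowest level; by the chain condition it
    lies behind all other leaves of \<open>Y\<close> as well, at their own levels.\<close>
  define \<omega> where "\<omega> = w y0"
  have \<omega>: "\<omega> \<in> S" "\<omega> \<notin> Y" "lt y0 \<omega>" "\<delta> y0 \<omega> = L y0"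
    using w[of y0] y01 YX unfolding \<omega>_def L_def by auto
  have top: "lt y \<omega> \<and> \<delta> y \<omega> = L y" if "y \<in> Y" for y
  proof (cases "y = y0")
    case False
    then have "lt y y0" using lt_total[OF False] chainY[of y0 y] ge[OF that] that y01 by auto
    then show ?thesis
      using chainY[of y y0] ultra[of y y0 \<omega>] lt_trans[of y y0 \<omega>] that y01 \<omega> by auto
  qed (use \<omega> in auto)
  have distY: "\<delta> x y = max (L x) (L y)" if "x \<in> Y" "y \<in> Y" "x \<noteq> y" for x y
    using lt_total[OF that(3)] chainY[of x y] chainY[of y x] that dist_sym[of x y] by auto
  let ?e = "insert \<omega> Y"
  have dist: "\<delta> x y \<le> L y1 \<and> \<delta> x y \<in> L ` Y" if "x \<in> ?e" "y \<in> ?e" "x \<noteq> y" for x y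
    using that top[of x] top[of y] le[of x] le[of y] distY[of x y] dist_sym[of x y] by (auto simp: max_def)
  have "isolated \<delta> ?e y1"
    unfolding isolated_def
  proof (intro conjI ballI impI)
    fix q x y assume "q \<in> ?e" "q \<noteq> y1" "x \<in> ?e" "y \<in> ?e" "x \<noteq> y"
    moreover from this have "\<delta> y1 q = L y1"
      using top[of y1] distY[of y1 q] le[of q] y01 by auto
    ultimately show "\<delta> x y \<le> \<delta> y1 q" using dist by auto
  qed (use y01 in auto)
  moreover have "descending lt \<delta> ?e"
    unfolding descending_def
  proof (intro ballI impI)
    fix x y z assume xyz: "x \<in> ?e" "y \<in> ?e" "z \<in> ?e" "lt x y" "lt y z"
    have last: "\<not> lt \<omega> v" if "v \<in> ?e" for v
      using that top lt_irrefl lt_trans by (metis insertE)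
    have xy: "x \<in> Y" "y \<in> Y" using xyz last by blast+
    have "\<delta> y z = L y"
      using xyz(3) top[OF xy(2)] chainY[of y z] xy xyz(5) by auto
    then show "\<delta> y z < \<delta> x y" using chainY[of x y] xy xyz(4) by simp
  qed
  moreover have "levels \<delta> ?e = d"
  proof
    show "levels \<delta> ?e \<subseteq> d" using dist unfolding levels_def dY by blast
    show "d \<subseteq> levels \<delta> ?e"
    proof
      fix l assume "l \<in> d"
      then obtain y where "y \<in> Y" "l = L y" unfolding dY by auto
      then have "l = \<delta> y \<omega>" "y \<in> ?e" "\<omega> \<in> ?e" "y \<noteq> \<omega>" using top \<omega> by auto
      then show "l \<in> levels \<delta> ?e" unfolding levels_def by blast
    qed
  qed
  ultimately have "step_color lt \<delta> \<chi> ?e = \<chi> d mod 4" unfolding step_color_def by auto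
  moreover have "?e \<subseteq> S" "card ?e = Suc k" using \<omega> YX X finY cardY by auto
  ultimately show thesis by (rule that[rotated 2])
qed

text \<open>Merging arranges the levels of both paths in one chain, so they are distinct and every
  \<open>k\<close>-set of them lifts to leaves. Index 0 is left out because \<open>no_twin\<close>
  needs an earlier leaf, and \<open>h\<close> exceeds \<open>g\<close> by \<open>k\<close> because
  \<open>k\<close> leaves from \<open>s\<close> on are needed.\<close>

lemma level_groups:
  assumes k: "k \<ge> 3" and h: "g + k \<le> h" and a: "descending_seq a h" and b: "descending_seq b h"
    and disj: "a ` {..<h} \<inter> b ` {..<h} = {}"
    and mono: "\<And>e. e \<subseteq> a ` {..<h} \<union> b ` {..<h} \<Longrightarrow> card e = Suc k \<Longrightarrow>
                 step_color lt \<delta> \<chi> e = c"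
  shows "level a ` {1..g} \<inter> level b ` {1..g} = {}"
    and "d \<in> [level a ` {1..g} \<union> level b ` {1..g}]\<^bsup>k\<^esup> \<Longrightarrow> \<chi> d mod 4 = c"
proof -
  have mono': "step_color lt \<delta> \<chi> e = c" if "e \<subseteq> b ` {..<h} \<union> a ` {..<h}" "card e = Suc k" for e
    using mono that by blast
  have disj': "b ` {..<h} \<inter> a ` {..<h} = {}" using disj by blast
  have ab: "\<delta> (a s) (b j) = level a s \<and> level b j < level a s"
    if "s \<in> {1..g}" "j \<in> {1..g}" "lt (a s) (b j)" for s j
    using merge_levels[OF k a b _ _ _ _ disj mono] that h by auto
  have ba: "\<delta> (b j) (a s) = level b j \<and> level a s < level b j"
    if "s \<in> {1..g}" "j \<in> {1..g}" "lt (b j) (a s)" for s j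
    using merge_levels[OF k b a _ _ _ _ disj' mono'] that h by auto
  have neq: "a s \<noteq> b j" if "s < h" "j < h" for s j using disj that by auto
  show "level a ` {1..g} \<inter> level b ` {1..g} = {}"
  proof (rule ccontr)
    assume "\<not> ?thesis"
    then obtain l where "l \<in> level a ` {1..g}" "l \<in> level b ` {1..g}" by blast
    then obtain s j where sj: "s \<in> {1..g}" "j \<in> {1..g}" "level a s = level b j"
      by (elim imageE) metis
    then have "a s \<noteq> b j" using neq h k by auto
    then show False using lt_total[of "a s" "b j"] ab[of s j] ba[of s j] sj by auto
  qed
  assume d: "d \<in> [level a ` {1..g} \<union> level b ` {1..g}]\<^bsup>k\<^esup>"
  let ?X = "a ` {1..g} \<union> b ` {1..g}" and ?S = "a ` {..<h} \<union> b ` {..<h}"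
  \<comment> \<open>Each leaf is sent to the last leaf of its own path, whose index
    \<open>h - 1\<close> is above \<open>g\<close>.\<close>
  define w where "w x = (if x \<in> a ` {..<h} then a (h - 1) else b (h - 1))" for x
  have wa: "w (a s) = a (h - 1)" "\<delta> (a s) (w (a s)) = level a s" "lt (a s) (w (a s))"
    if "s \<in> {1..g}" for s
    using that h k descending_seq_level[OF a, of s "h - 1"] descending_seq_lt[OF a, of s "h - 1"]
    by (auto simp: w_def)
  have wb: "w (b s) = b (h - 1)" "\<delta> (b s) (w (b s)) = level b s" "lt (b s) (w (b s))"
    if "s \<in> {1..g}" for s
  proof -
    have "b s \<notin> a ` {..<h}" using that neq[of _ s] h k by fastforce
    then show "w (b s) = b (h - 1)" by (simp add: w_def)
    then show "\<delta> (b s) (w (b s)) = level b s" "lt (b s) (w (b s))"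
      using that h k descending_seq_level[OF b, of s "h - 1"] descending_seq_lt[OF b, of s "h - 1"]
      by auto
  qed
  have img: "(\<lambda>x. \<delta> x (w x)) ` ?X = level a ` {1..g} \<union> level b ` {1..g}"
    unfolding image_Un image_image using wa(2) wb(2) by simp
  have desc: "\<delta> (v s) (v t) = level v s \<and> level v t < level v s"
    if v: "descending_seq v h" and st: "s \<in> {1..g}" "t \<in> {1..g}" "lt (v s) (v t)" for v s t
  proof -
    have "s < t"
      using st descending_seq_lt[OF v, of t s] lt_irrefl lt_trans[of "v s" "v t" "v s"] h k
      by (cases s t rule: linorder_cases) auto
    then show ?thesis
      using descending_seq_level[OF v, of s t] descending_seq_level_less[OF v, of s t] st h k by auto
  qed
  obtain e where "e \<subseteq> ?S" "card e = Suc k" "step_color lt \<delta> \<chi> e = \<chi> d mod 4"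
  proof (rule lift_color[of k ?X ?S w d \<chi>])
    show "?X \<subseteq> ?S" using h k by auto
    show "d \<in> [(\<lambda>x. \<delta> x (w x)) ` ?X]\<^bsup>k\<^esup>" using d img by simp
    have "a (h - 1) \<notin> ?X" "b (h - 1) \<notin> ?X"
    proof -
      have "a s \<noteq> a (h - 1) \<and> b s \<noteq> b (h - 1) \<and> a s \<noteq> b (h - 1) \<and> b s \<noteq> a (h - 1)"
        if s: "s \<in> {1..g}" for s
        using wa[OF s] wb[OF s] lt_neq neq[of s "h - 1"] neq[of "h - 1" s] s h k by auto
      then show "a (h - 1) \<notin> ?X" "b (h - 1) \<notin> ?X" by (auto dest: sym)
    qed
    then show "lt x (w x) \<and> w x \<in> ?S \<and> w x \<notin> ?X" if "x \<in> ?X" for x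
      using that wa wb h k by auto
    show "\<delta> x y = \<delta> x (w x) \<and> \<delta> y (w y) < \<delta> x (w x)"
      if "x \<in> ?X" "y \<in> ?X" "lt x y" for x y
      using that wa(2) wb(2) ab ba desc[OF a] desc[OF b] by auto
  qed (use k in auto)
  then show "\<chi> d mod 4 = c" using mono by simp
qed

lemma card_levels:
  assumes "descending_seq a h" "Suc g < h"
  shows "card (level a ` {1..g}) = g"
proof -
  have "inj_on (level a) {1..g}"
  proof (rule inj_onI)
    fix i j assume "i \<in> {1..g}" "j \<in> {1..g}" "level a i = level a j"
    then show "i = j"
      using descending_seq_level_less[OF assms(1), of i j] descending_seq_level_less[OF assms(1), of j i]
        assms(2) by (cases i j rule: linorder_cases) auto
  qed
  then show ?thesis by (simp add: card_image)
qed

end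

section \<open>Stepping up\<close>

text \<open>\<open>x div 2 ^ d\<close> is the ancestor of the leaf \<open>x\<close> at height
  \<open>d\<close>, so this is the height of the lowest common ancestor.\<close>

definition merge_height :: "nat \<Rightarrow> nat \<Rightarrow> nat" where
  "merge_height x y = (LEAST d. x div 2 ^ d = y div 2 ^ d)"

text \<open>For \<open>x \<noteq> y\<close> this is the position of the highest bit in which \<open>x\<close> and \<open>y\<close> differ.\<close>

definition branch :: "nat \<Rightarrow> nat \<Rightarrow> nat" where
  "branch x y = merge_height x y - 1"

lemma div_power_2_eq_mono:
  fixes x y :: nat
  assumes "x div 2 ^ d = y div 2 ^ d" "d \<le> d'"
  shows "x div 2 ^ d' = y div 2 ^ d'"
proof -
  have "2 ^ d' = 2 ^ d * (2 :: nat) ^ (d' - d)" using assms by (simp flip: power_add)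
  then show ?thesis using assms by (simp add: div_mult2_eq)
qed

lemma merge_height_le_iff: "merge_height x y \<le> d \<longleftrightarrow> x div 2 ^ d = y div 2 ^ d"
proof
  \<comment> \<open>At height \<open>x + y\<close> both quotients vanish, so the minimum
    exists.\<close>
  have "x < 2 ^ (x + y)" "y < 2 ^ (x + y)"
    by (meson less_exp le_add1 le_add2 le_less_trans less_le_trans one_le_numeral power_increasing)+
  then have "x div 2 ^ (x + y) = y div 2 ^ (x + y)" by simp
  then have "x div 2 ^ merge_height x y = y div 2 ^ merge_height x y"
    unfolding merge_height_def by (rule LeastI)
  then show "x div 2 ^ d = y div 2 ^ d" if "merge_height x y \<le> d"
    using div_power_2_eq_mono that by blast
qed (simp add: merge_height_def Least_le)

lemma merge_height_pos: "x \<noteq> y \<Longrightarrow> merge_height x y > 0"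
  using merge_height_le_iff[of x y 0] by (cases "merge_height x y") auto

interpretation nat_tree: ordered_tree "(<)" branch
proof
  show "branch x y = branch y x" for x y
    unfolding branch_def merge_height_def by metis
  fix x y z :: nat assume xyz: "x < y" "y < z"
  \<comment> \<open>Ancestors at a fixed height are ordered like the leaves, so \<open>x\<close> and
    \<open>z\<close> share one exactly when \<open>y\<close> shares it too.\<close>
  have iff: "merge_height x z \<le> d \<longleftrightarrow> max (merge_height x y) (merge_height y z) \<le> d" for d
    using xyz div_le_mono[of x y "2 ^ d"] div_le_mono[of y z "2 ^ d"]
    by (auto simp: merge_height_le_iff)
  have "merge_height x z = max (merge_height x y) (merge_height y z)"
  proof (rule order_antisym)
    show "merge_height x z \<le> max (merge_height x y) (merge_height y z)" by (subst iff) simp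
    show "max (merge_height x y) (merge_height y z) \<le> merge_height x z" by (subst iff[symmetric]) simp
  qed
  then show "branch x z = max (branch x y) (branch y z)"
    by (auto simp: branch_def max_def)
  \<comment> \<open>Otherwise three different nodes at height \<open>d\<close> would have the same
    parent.\<close>
  show "branch x y \<noteq> branch y z"
  proof
    assume "branch x y = branch y z"
    then obtain d where d: "merge_height x y = Suc d" "merge_height y z = Suc d"
      using merge_height_pos[of x y] merge_height_pos[of y z] xyz unfolding branch_def
      by (metis Suc_pred' less_irrefl One_nat_def)
    then have "x div 2 ^ d \<noteq> y div 2 ^ d" "y div 2 ^ d \<noteq> z div 2 ^ d"
      using merge_height_le_iff[of x y d] merge_height_le_iff[of y z d] by auto
    then have "x div 2 ^ d < y div 2 ^ d" "y div 2 ^ d < z div 2 ^ d"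
      using xyz div_le_mono[of x y "2 ^ d"] div_le_mono[of y z "2 ^ d"] by auto
    moreover have "x div 2 ^ Suc d = z div 2 ^ Suc d"
      using d merge_height_le_iff by (metis order_refl)
    then have "x div 2 ^ d div 2 = z div 2 ^ d div 2"
      by (simp only: power_Suc2 div_mult2_eq)
    ultimately show False by linarith
  qed
qed auto

interpretation nat_tree_rev: ordered_tree "\<lambda>x y. y < x" branch
  by (rule nat_tree.converse)

lemma branch_less:
  assumes "x < 2 ^ N" "y < 2 ^ N" "x \<noteq> y"
  shows "branch x y < N"
proof -
  have "merge_height x y \<le> N" using assms by (simp add: merge_height_le_iff)
  then show ?thesis
    using merge_height_pos[OF assms(3)] by (simp add: branch_def)
qed

text \<open>A triple has just two consecutive branching levels, and \<open>binary\<close> makes them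
  different.\<close>

lemma descending_or_ascending:
  assumes "e \<in> [UNIV]\<^bsup>3\<^esup>"
  shows "descending (<) branch e \<or> descending (\<lambda>x y. y < x) branch e"
proof -
  obtain x y z where e: "e = {x, y, z}" "x < y" "y < z"
    using assms by (auto simp: ordered_nsets_3_eq)
  have s: "branch y x = branch x y" "branch z y = branch y z" by (rule nat_tree.dist_sym)+
  show ?thesis
    using nat_tree.binary[OF e(2,3)] e s by (cases "branch y z < branch x y") (auto simp: descending_def)
qed

text \<open>Ramsey's theorem for triples, colored by their side: being descending is a condition on
  triples, so a homogeneous set has it or its mirror image. \<open>M\<close> depends on
  \<open>h\<close> alone and thus affects only the constant.\<close>

lemma large_set_has_descending_subset:
  obtains M where "\<And>S. card S \<ge> M \<Longrightarrow> finite S \<Longrightarrow> \<exists>T\<subseteq>S. card T = h \<and>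
    (descending (<) branch T \<or> descending (\<lambda>x y. y < x) branch T)"
proof -
  obtain M :: nat where M: "partn_lst {..<M} [h, h] 3" using ramsey_full by blast
  show thesis
  proof (rule that[of M])
    fix S :: "nat set" assume S: "card S \<ge> M" "finite S"
    obtain u where u: "bij_betw u {..<card S} S"
      using ex_bij_betw_nat_finite[OF S(2)] by (auto simp: lessThan_atLeast0)
    define f where "f e = (if descending (<) branch (u ` e) then 0 else 1 :: nat)" for e
    have "partn_lst {..<card S} [h, h] 3" using partn_lst_greater_resource[OF M S(1)] .
    moreover have "f \<in> [{..<card S}]\<^bsup>3\<^esup> \<rightarrow> {..<2}" by (auto simp: f_def)
    ultimately obtain i H where iH: "i < length [h, h]" "H \<in> [{..<card S}]\<^bsup>([h, h] ! i)\<^esup>"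
      "f ` [H]\<^bsup>3\<^esup> \<subseteq> {i}"
      by (rule partn_lstE) auto
    then have "[h, h] ! i = h" by (cases i) auto
    with iH have H: "H \<subseteq> {..<card S}" "card H = h" by (auto simp: nsets_def)
    have inj: "inj_on u H" using u H inj_on_subset unfolding bij_betw_def by blast
    have hom: "descending (<) branch {x, y, z} \<longleftrightarrow> i = 0"
      if "x \<in> u ` H" "y \<in> u ` H" "z \<in> u ` H" "x < y" "y < z" for x y z
    proof -
      have "{x, y, z} \<in> [u ` H]\<^bsup>3\<^esup>" using that by (auto simp: nsets_def)
      then obtain e where e: "e \<in> [H]\<^bsup>3\<^esup>" "{x, y, z} = u ` e"
        using inj by (rule nset_image_obtains)
      then have "f e = i" using iH(3) by blast
      then show ?thesis using e(2) by (auto simp: f_def split: if_splits)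
    qed
    have hom': "descending (<) branch {x, y, z} \<or> descending (\<lambda>x y. y < x) branch {x, y, z}"
      if "x < y" "y < z" for x y z
      using that by (intro descending_or_ascending) (auto simp: nsets_def)
    have "descending (<) branch (u ` H) \<or> descending (\<lambda>x y. y < x) branch (u ` H)"
    proof (cases "i = 0")
      case True
      have "branch y z < branch x y" if "x \<in> u ` H" "y \<in> u ` H" "z \<in> u ` H" "x < y" "y < z" for x y z
        using hom[OF that] True that unfolding descending_def by blast
      then show ?thesis unfolding descending_def by blast
    next
      case False
      have "branch y x < branch z y" if "x \<in> u ` H" "y \<in> u ` H" "z \<in> u ` H" "x < y" "y < z" for x y z
        using hom[OF that] hom'[OF that(4,5)] False that unfolding descending_def by blast
      then show ?thesis unfolding descending_def by blast
    qed
    moreover have "u ` H \<subseteq> S" using u H by (auto simp: bij_betw_def)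
    moreover have "card (u ` H) = h" using inj H by (simp add: card_image)
    ultimately show "\<exists>T\<subseteq>S. card T = h \<and>
      (descending (<) branch T \<or> descending (\<lambda>x y. y < x) branch T)" by blast
  qed
qed

text \<open>A mirrored set is listed from right to left, which makes it a sequence of the reversed
  tree.\<close>

lemma descending_enumeration:
  assumes "finite T"
  shows "descending (<) branch T \<Longrightarrow>
           \<exists>a. nat_tree.descending_seq a (card T) \<and> a ` {..<card T} = T"
    and "descending (\<lambda>x y. y < x) branch T \<Longrightarrow>
           \<exists>a. nat_tree_rev.descending_seq a (card T) \<and> a ` {..<card T} = T"
proof -
  define xs where "xs = sorted_list_of_set T"
  have xs: "set xs = T" "length xs = card T" "sorted_wrt (<) xs"
    using assms by (auto simp: xs_def)
  have inT: "ys ! i \<in> T" if "i < card T" "ys = xs \<or> ys = rev xs" for i ys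
    using that xs by (metis length_rev nth_mem set_rev)
  have img: "(!) ys ` {..<length ys} = set ys" for ys :: "nat list"
    by (auto simp: set_conv_nth)
  {
    assume d: "descending (<) branch T"
    have lt: "xs ! i < xs ! j" if "i < j" "j < card T" for i j
      using sorted_wrt_nth_less[OF xs(3)] that xs by auto
    have "nat_tree.descending_seq ((!) xs) (card T)"
      unfolding nat_tree.descending_seq_def
    proof (intro conjI allI impI)
      fix i j l assume "i < j" "j < l" "l < card T"
      then show "branch (xs ! j) (xs ! l) < branch (xs ! i) (xs ! j)"
        using d lt[of i j] lt[of j l] inT unfolding descending_def by auto
    qed (use lt in auto)
    moreover have "(!) xs ` {..<card T} = T"
      using img[of xs] xs by simp
    ultimately show "\<exists>a. nat_tree.descending_seq a (card T) \<and> a ` {..<card T} = T" by blast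
  }
  {
    assume d: "descending (\<lambda>x y. y < x) branch T"
    have "sorted_wrt (\<lambda>x y. y < x) (rev xs)" using xs by (simp add: sorted_wrt_rev)
    then have lt: "rev xs ! j < rev xs ! i" if "i < j" "j < card T" for i j
      using sorted_wrt_nth_less that xs by fastforce
    have "nat_tree_rev.descending_seq ((!) (rev xs)) (card T)"
      unfolding nat_tree_rev.descending_seq_def
    proof (intro conjI allI impI)
      fix i j l assume "i < j" "j < l" "l < card T"
      then show "branch (rev xs ! j) (rev xs ! l) < branch (rev xs ! i) (rev xs ! j)"
        using d lt[of i j] lt[of j l] inT unfolding descending_def by auto
    qed (use lt in auto)
    moreover have "(!) (rev xs) ` {..<card T} = T"
      using img[of "rev xs"] xs by simp
    ultimately show "\<exists>a. nat_tree_rev.descending_seq a (card T) \<and> a ` {..<card T} = T" by blast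
  }
qed

section \<open>Monochromatic copies and their transfer one uniformity down\<close>

text \<open>Stands for a monochromatic copy of the two-group hypergraph. Giving the images of the
  groups instead of an embedding makes it easy to drop groups and to replace them by sets of
  levels.\<close>

definition two_group_mono ::
  "nat \<Rightarrow> nat \<Rightarrow> nat \<Rightarrow> nat \<Rightarrow> (nat set \<Rightarrow> nat) \<Rightarrow> bool" where
  "two_group_mono k n g N f \<longleftrightarrow>
     (\<exists>A c. (\<forall>i<n. A i \<in> [{..<N}]\<^bsup>g\<^esup>) \<and>
        (\<forall>i<n. \<forall>j<n. i \<noteq> j \<longrightarrow> A i \<inter> A j = {} \<and> (\<forall>e\<in>[A i \<union> A j]\<^bsup>k\<^esup>. f e = c)))"

lemma two_group_monoE:
  assumes "two_group_mono k n g N f"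
  obtains A c where "\<And>i. i < n \<Longrightarrow> A i \<in> [{..<N}]\<^bsup>g\<^esup>"
    "\<And>i j. i < n \<Longrightarrow> j < n \<Longrightarrow> i \<noteq> j \<Longrightarrow> A i \<inter> A j = {} \<and> (\<forall>e\<in>[A i \<union> A j]\<^bsup>k\<^esup>. f e = c)"
proof -
  obtain A c where "(\<forall>i<n. A i \<in> [{..<N}]\<^bsup>g\<^esup>) \<and>
      (\<forall>i<n. \<forall>j<n. i \<noteq> j \<longrightarrow> A i \<inter> A j = {} \<and> (\<forall>e\<in>[A i \<union> A j]\<^bsup>k\<^esup>. f e = c))"
    using assms unfolding two_group_mono_def by (elim exE)
  then show thesis by (intro that[of A c]) auto
qed

lemma (in ordered_tree) two_group_mono_levels:
  assumes k: "k \<ge> 3" and h: "h = g + k"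
    and N: "\<And>x y. x \<in> S \<Longrightarrow> y \<in> S \<Longrightarrow> x \<noteq> y \<Longrightarrow> \<delta> x y < N"
    and \<chi>: "\<chi> \<in> [{..<N}]\<^bsup>k\<^esup> \<rightarrow> {..<4}"
    and A: "\<And>i. i < m \<Longrightarrow> A i \<subseteq> S"
    and pairs: "\<And>i j. i < m \<Longrightarrow> j < m \<Longrightarrow> i \<noteq> j \<Longrightarrow>
          A i \<inter> A j = {} \<and> (\<forall>e\<in>[A i \<union> A j]\<^bsup>Suc k\<^esup>. step_color lt \<delta> \<chi> e = c)"
    and n: "n \<le> card {i. i < m \<and> (\<exists>a. descending_seq a h \<and> a ` {..<h} \<subseteq> A i)}"
  shows "two_group_mono k n g N \<chi>"
proof -
  obtain J where J: "J \<subseteq> {i. i < m \<and> (\<exists>a. descending_seq a h \<and> a ` {..<h} \<subseteq> A i)}"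
    "card J = n" "finite J"
    using n by (meson obtain_subset_with_card_n)
  then obtain \<sigma> where \<sigma>: "bij_betw \<sigma> {..<n} J"
    using ex_bij_betw_nat_finite[OF J(3)] by (auto simp: lessThan_atLeast0)
  have \<sigma>m: "\<sigma> i < m" "\<exists>a. descending_seq a h \<and> a ` {..<h} \<subseteq> A (\<sigma> i)" if "i < n" for i
    using \<sigma> J that by (auto simp: bij_betw_def)
  then obtain a where a: "\<And>i. i < n \<Longrightarrow> descending_seq (a i) h"
    and aA: "\<And>i. i < n \<Longrightarrow> a i ` {..<h} \<subseteq> A (\<sigma> i)"
    by metis
  have sub: "level (a i) ` {1..g} \<subseteq> {..<N}" if "i < n" for i
  proof clarify
    fix s assume "s \<in> {1..g}"
    then have sh: "s < h" "Suc s < h" using h k by auto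
    then have "a i s \<noteq> a i (Suc s)"
      using lt_neq descending_seq_lt[OF a[OF that], of s "Suc s"] by blast
    moreover have "a i s \<in> S" "a i (Suc s) \<in> S" using aA[OF that] A \<sigma>m(1)[OF that] sh by blast+
    ultimately show "level (a i) s < N" by (intro N)
  qed
  show ?thesis
    unfolding two_group_mono_def
  proof (intro exI[of _ "\<lambda>i. level (a i) ` {1..g}"] exI[of _ c] conjI allI impI ballI)
    show "level (a i) ` {1..g} \<in> [{..<N}]\<^bsup>g\<^esup>" if "i < n" for i
      using sub[OF that] card_levels[OF a[OF that], of g] h k by (auto simp: nsets_def)
    fix i j assume ij: "i < n" "j < n" "i \<noteq> j"
    then have "\<sigma> i \<noteq> \<sigma> j" using \<sigma> by (auto simp: bij_betw_def inj_on_def)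
    note p = pairs[OF \<sigma>m(1)[OF ij(1)] \<sigma>m(1)[OF ij(2)] this]
    have disj: "a i ` {..<h} \<inter> a j ` {..<h} = {}" using p aA ij by blast
    have mono: "step_color lt \<delta> \<chi> e = c"
      if "e \<subseteq> a i ` {..<h} \<union> a j ` {..<h}" "card e = Suc k" for e
    proof -
      have "finite e" using that by (intro card_ge_0_finite) simp
      then have "e \<in> [A (\<sigma> i) \<union> A (\<sigma> j)]\<^bsup>Suc k\<^esup>"
        using that aA[OF ij(1)] aA[OF ij(2)] by (auto simp: nsets_def)
      then show ?thesis using p by blast
    qed
    have hg: "g + k \<le> h" using h by simp
    note lg = level_groups[OF k hg a[OF ij(1)] a[OF ij(2)] disj mono]
    show "level (a i) ` {1..g} \<inter> level (a j) ` {1..g} = {}" using lg(1) by simp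
    fix d assume d: "d \<in> [level (a i) ` {1..g} \<union> level (a j) ` {1..g}]\<^bsup>k\<^esup>"
    then have "d \<in> [{..<N}]\<^bsup>k\<^esup>"
      using nsets_mono[OF Un_least[OF sub[OF ij(1)] sub[OF ij(2)]]] by blast
    then have "\<chi> d < 4" using \<chi> by auto
    moreover have "\<chi> d mod 4 = c" using lg(2) d by simp
    ultimately show "\<chi> d = c" by simp
  qed
qed

text \<open>\<open>G\<close> must not depend on \<open>n\<close>, \<open>N\<close> or
  \<open>\<chi>\<close>, since it enters the edge count as a constant. The factor 2 before
  \<open>n\<close> pays for keeping the groups of one side only.\<close>

lemma step_up:
  assumes k: "k \<ge> 3"
  obtains G where "G \<ge> k"
    "\<And>n N \<chi>. \<chi> \<in> [{..<N}]\<^bsup>k\<^esup> \<rightarrow> {..<4} \<Longrightarrow> \<not> two_group_mono k n g N \<chi> \<Longrightarrow>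
       \<not> two_group_mono (Suc k) (2 * n) G (2 ^ N) (step_color (<) branch \<chi>)"
proof -
  define h where "h = g + k"
  obtain M where M: "\<And>S. card S \<ge> M \<Longrightarrow> finite S \<Longrightarrow> \<exists>T\<subseteq>S. card T = h \<and>
    (descending (<) branch T \<or> descending (\<lambda>x y. y < x) branch T)"
    using large_set_has_descending_subset[of h] by blast
  show thesis
  \<comment> \<open>\<open>M\<close> provides the paths; \<open>k\<close> makes two groups large
    enough to hold an edge of the new uniformity.\<close>
  proof (rule that[of "max M k"])
    fix n N :: nat and \<chi> :: "nat set \<Rightarrow> nat"
    assume \<chi>: "\<chi> \<in> [{..<N}]\<^bsup>k\<^esup> \<rightarrow> {..<4}" and avoid: "\<not> two_group_mono k n g N \<chi>"
    show "\<not> two_group_mono (Suc k) (2 * n) (max M k) (2 ^ N) (step_color (<) branch \<chi>)"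
    proof
      assume "two_group_mono (Suc k) (2 * n) (max M k) (2 ^ N) (step_color (<) branch \<chi>)"
      then obtain A c where A: "\<And>i. i < 2 * n \<Longrightarrow> A i \<in> [{..<2 ^ N}]\<^bsup>max M k\<^esup>"
        and pair: "\<And>i j. i < 2 * n \<Longrightarrow> j < 2 * n \<Longrightarrow> i \<noteq> j \<Longrightarrow> A i \<inter> A j = {} \<and>
          (\<forall>e\<in>[A i \<union> A j]\<^bsup>Suc k\<^esup>. step_color (<) branch \<chi> e = c)"
        by (rule two_group_monoE) blast
      have sub: "A i \<subseteq> {..<2 ^ N}" if "i < 2 * n" for i using A[OF that] by (auto simp: nsets_def)
      have N: "branch x y < N" if "x \<in> {..<2 ^ N}" "y \<in> {..<2 ^ N}" "x \<noteq> y" for x y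
        using branch_less that by simp
      let ?U = "{i. i < 2 * n \<and> (\<exists>a. nat_tree.descending_seq a h \<and> a ` {..<h} \<subseteq> A i)}"
      let ?D = "{i. i < 2 * n \<and> (\<exists>a. nat_tree_rev.descending_seq a h \<and> a ` {..<h} \<subseteq> A i)}"
      have "i \<in> ?U \<union> ?D" if "i < 2 * n" for i
      proof -
        have "card (A i) \<ge> M" "finite (A i)" using A[OF that] by (auto simp: nsets_def)
        then obtain T where T: "T \<subseteq> A i" "card T = h"
          "descending (<) branch T \<or> descending (\<lambda>x y. y < x) branch T"
          using M by blast
        have "finite T" using T(1) \<open>finite (A i)\<close> finite_subset by blast
        then have "\<exists>a. (nat_tree.descending_seq a h \<or> nat_tree_rev.descending_seq a h) \<and>
            a ` {..<h} = T"
          using descending_enumeration[of T] T by metis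
        then show ?thesis using T(1) that by blast
      qed
      then have eq: "{..<2 * n} = ?U \<union> ?D" by auto
      have "card {..<2 * n} \<le> card ?U + card ?D" unfolding eq by (rule card_Un_le)
      then consider "n \<le> card ?U" | "n \<le> card ?D" by fastforce
      then show False
      proof cases
        case 1
        have "two_group_mono k n g N \<chi>"
          by (rule nat_tree.two_group_mono_levels[OF k h_def _ \<chi>]) (fact N sub pair 1)+
        then show False using avoid by simp
      next
        case 2
        from pair have pair': "A i \<inter> A j = {} \<and>
          (\<forall>e\<in>[A i \<union> A j]\<^bsup>Suc k\<^esup>. step_color (\<lambda>x y. y < x) branch \<chi> e = c)"
          if "i < 2 * n" "j < 2 * n" "i \<noteq> j" for i j
          using that unfolding step_color_converse[of "(<)"] by blast
        have "two_group_mono k n g N \<chi>"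
          by (rule nat_tree_rev.two_group_mono_levels[OF k h_def _ \<chi>]) (fact N sub pair' 2)+
        then show False using avoid by simp
      qed
    qed
  qed simp
qed

section \<open>From graphs to triples\<close>

text \<open>In a descending triple the first leaf is equally far from the other two. For
  \<open>{a, b, a'}\<close> this identifies \<open>\<delta> a a'\<close> with the level of the first
  pair, so \<open>{a, a', b'}\<close> sees exactly the levels of both pairs.\<close>

lemma (in ordered_tree) two_pairs_levels:
  assumes lts: "lt a b" "lt a' b'" "lt a a'" and neq: "b \<noteq> a'" "b \<noteq> b'"
    and desc: "\<And>x. x \<in> {a', b'} \<Longrightarrow> descending lt \<delta> {a, b, x}" "descending lt \<delta> {a, a', b'}"
  shows "\<delta> a' b' < \<delta> a b" "levels \<delta> {a, a', b'} = {\<delta> a b, \<delta> a' b'}"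
proof -
  have ab: "\<delta> a a' = \<delta> a b"
    using lt_total[OF neq(1)]
  proof
    assume "lt b a'"
    moreover have "\<delta> b a' < \<delta> a b"
      using desc(1)[of a'] lts(1) \<open>lt b a'\<close> unfolding descending_def by blast
    ultimately show ?thesis using ultra[OF lts(1)] by auto
  next
    assume "lt a' b"
    moreover have "\<delta> a' b < \<delta> a a'"
      using desc(1)[of a'] lts(3) \<open>lt a' b\<close> unfolding descending_def by blast
    ultimately show ?thesis using ultra[OF lts(3)] by auto
  qed
  have less: "\<delta> a' b' < \<delta> a a'"
    using desc(2) lts unfolding descending_def by blast
  then show "\<delta> a' b' < \<delta> a b" using ab by simp
  have "\<delta> a b' = \<delta> a a'" using ultra[OF lts(3,2)] less by simp
  moreover have "a \<noteq> a'" "a' \<noteq> b'" "a \<noteq> b'" using lts lt_neq lt_trans by blast+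
  ultimately have "levels \<delta> {a, a', b'} = {\<delta> a a', \<delta> a' b'}"
    unfolding levels_def using dist_sym[of a' a] dist_sym[of b' a'] dist_sym[of b' a] by auto
  then show "levels \<delta> {a, a', b'} = {\<delta> a b, \<delta> a' b'}" using ab by simp
qed

text \<open>Each pair of leaves shrinks to one vertex, its branching level, so two groups turn into
  an edge of the graph.\<close>

lemma (in ordered_tree) two_group_mono_pair_levels:
  assumes N: "\<And>x y. x \<in> S \<Longrightarrow> y \<in> S \<Longrightarrow> x \<noteq> y \<Longrightarrow> \<delta> x y < N"
    and \<chi>: "\<chi> \<in> [{..<N}]\<^bsup>2\<^esup> \<rightarrow> {..<2}"
    and A: "\<And>i. i < n \<Longrightarrow> A i \<in> [S]\<^bsup>2\<^esup>"
    and pairs: "\<And>i j. i < n \<Longrightarrow> j < n \<Longrightarrow> i \<noteq> j \<Longrightarrow> A i \<inter> A j = {} \<and>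
          (\<forall>e\<in>[A i \<union> A j]\<^bsup>3\<^esup>. descending lt \<delta> e \<and> \<chi> (levels \<delta> e) mod 2 = c)"
  shows "two_group_mono 2 n 1 N \<chi>"
proof -
  have "\<exists>a b. A i = {a, b} \<and> lt a b" if i: "i < n" for i
  proof -
    obtain x y where "A i = {x, y}" "x \<noteq> y" using A[OF i] by (rule nsets2_E)
    then show ?thesis using lt_total[of x y] by (auto simp: insert_commute)
  qed
  then obtain a b where ab: "\<And>i. i < n \<Longrightarrow> A i = {a i, b i}" "\<And>i. i < n \<Longrightarrow> lt (a i) (b i)"
    by metis
  have order: "\<delta> (a j) (b j) < \<delta> (a i) (b i) \<and> \<chi> {\<delta> (a i) (b i), \<delta> (a j) (b j)} mod 2 = c"
    if ij: "i < n" "j < n" "i \<noteq> j" and lt: "lt (a i) (a j)" for i j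
  proof -
    have p: "A i \<inter> A j = {}"
      "\<And>e. e \<in> [A i \<union> A j]\<^bsup>3\<^esup> \<Longrightarrow> descending lt \<delta> e \<and> \<chi> (levels \<delta> e) mod 2 = c"
      using pairs[OF ij] by auto
    have neq: "a i \<noteq> b i" "a j \<noteq> b j" "a i \<noteq> a j" "a i \<noteq> b j" "b i \<noteq> a j" "b i \<noteq> b j"
      using p(1) ab[OF ij(1)] ab[OF ij(2)] lt_neq by auto
    then have "{a i, b i, a j} \<in> [A i \<union> A j]\<^bsup>3\<^esup>" "{a i, b i, b j} \<in> [A i \<union> A j]\<^bsup>3\<^esup>"
      "{a i, a j, b j} \<in> [A i \<union> A j]\<^bsup>3\<^esup>"
      using ab[OF ij(1)] ab[OF ij(2)] by (auto simp: nsets_def)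
    note p' = this[THEN p(2)]
    have "\<delta> (a j) (b j) < \<delta> (a i) (b i)" "levels \<delta> {a i, a j, b j} = {\<delta> (a i) (b i), \<delta> (a j) (b j)}"
      using two_pairs_levels[OF ab(2)[OF ij(1)] ab(2)[OF ij(2)] lt neq(5,6)] p' by auto
    then show ?thesis using p' by auto
  qed
  have less: "\<delta> (a i) (b i) < N" if "i < n" for i
    using A[OF that] ab[OF that] lt_neq[of "a i" "b i"] by (intro N) (auto simp: nsets_def)
  have both: "\<delta> (a i) (b i) \<noteq> \<delta> (a j) (b j) \<and> \<chi> {\<delta> (a i) (b i), \<delta> (a j) (b j)} = c"
    if ij: "i < n" "j < n" "i \<noteq> j" for i j
  proof -
    have "a i \<noteq> a j" using pairs[OF ij] ab(1)[OF ij(1)] ab(1)[OF ij(2)] by auto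
    then have *: "\<delta> (a i) (b i) \<noteq> \<delta> (a j) (b j) \<and> \<chi> {\<delta> (a i) (b i), \<delta> (a j) (b j)} mod 2 = c"
      using lt_total[of "a i" "a j"] order[OF ij] order[OF ij(2,1) ij(3)[symmetric]]
        insert_commute[of "\<delta> (a j) (b j)" "\<delta> (a i) (b i)" "{}"]
      by auto
    then have "{\<delta> (a i) (b i), \<delta> (a j) (b j)} \<in> [{..<N}]\<^bsup>2\<^esup>" using less ij by simp
    then have "\<chi> {\<delta> (a i) (b i), \<delta> (a j) (b j)} < 2" using \<chi> by auto
    then show ?thesis using * by auto
  qed
  show ?thesis
    unfolding two_group_mono_def
  proof (intro exI[of _ "\<lambda>i. {\<delta> (a i) (b i)}"] exI[of _ c] conjI allI impI)
    show "{\<delta> (a i) (b i)} \<in> [{..<N}]\<^bsup>1\<^esup>" if "i < n" for i using less that by (auto simp: nsets_def)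
    fix i j assume ij: "i < n" "j < n" "i \<noteq> j"
    show "{\<delta> (a i) (b i)} \<inter> {\<delta> (a j) (b j)} = {}"
      and "\<forall>e\<in>[{\<delta> (a i) (b i)} \<union> {\<delta> (a j) (b j)}]\<^bsup>2\<^esup>. \<chi> e = c"
      using both[OF ij] by (auto simp: insert_commute)
  qed
qed

text \<open>The stepping-up coloring of Erdos and Hajnal for triples, which doubles the number of
  colors.\<close>

definition triple_color :: "(nat set \<Rightarrow> nat) \<Rightarrow> nat set \<Rightarrow> nat" where
  "triple_color \<chi> e =
     2 * (\<chi> (levels branch e) mod 2) + (if descending (<) branch e then 1 else 0)"

lemma step_three:
  assumes \<chi>: "\<chi> \<in> [{..<N}]\<^bsup>2\<^esup> \<rightarrow> {..<2}" and avoid: "\<not> two_group_mono 2 n 1 N \<chi>"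
  shows "\<not> two_group_mono 3 n 2 (2 ^ N) (triple_color \<chi>)"
proof
  assume "two_group_mono 3 n 2 (2 ^ N) (triple_color \<chi>)"
  then obtain A c where A: "\<And>i. i < n \<Longrightarrow> A i \<in> [{..<2 ^ N}]\<^bsup>2\<^esup>"
    and pair: "\<And>i j. i < n \<Longrightarrow> j < n \<Longrightarrow> i \<noteq> j \<Longrightarrow> A i \<inter> A j = {} \<and>
      (\<forall>e\<in>[A i \<union> A j]\<^bsup>3\<^esup>. triple_color \<chi> e = c)"
    by (rule two_group_monoE) blast
  have N: "branch x y < N" if "x \<in> {..<2 ^ N}" "y \<in> {..<2 ^ N}" "x \<noteq> y" for x y
    using branch_less that by simp
  have col: "descending (<) branch e \<longleftrightarrow> odd c" "\<chi> (levels branch e) mod 2 = c div 2"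
    if "triple_color \<chi> e = c" for e
    using that by (auto simp: triple_color_def split: if_splits)
  show False
  \<comment> \<open>The parity of the common color fixes the side of all triples.\<close>
  proof (cases "odd c")
    case True
    have "A i \<inter> A j = {} \<and> (\<forall>e\<in>[A i \<union> A j]\<^bsup>3\<^esup>. descending (<) branch e \<and>
        \<chi> (levels branch e) mod 2 = c div 2)" if "i < n" "j < n" "i \<noteq> j" for i j
      using pair[OF that] col True by blast
    then have "two_group_mono 2 n 1 N \<chi>"
      by (intro nat_tree.two_group_mono_pair_levels[OF N \<chi> A]) auto
    then show False using avoid by simp
  next
    case False
    have "descending (\<lambda>x y. y < x) branch e" if "e \<in> [B]\<^bsup>3\<^esup>" "triple_color \<chi> e = c" for e B
      using descending_or_ascending[of e] col(1)[OF that(2)] False that(1) by (auto simp: nsets_def)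
    then have "A i \<inter> A j = {} \<and> (\<forall>e\<in>[A i \<union> A j]\<^bsup>3\<^esup>. descending (\<lambda>x y. y < x) branch e \<and>
        \<chi> (levels branch e) mod 2 = c div 2)" if "i < n" "j < n" "i \<noteq> j" for i j
      using pair[OF that] col(2) by blast
    then have "two_group_mono 2 n 1 N \<chi>"
      by (intro nat_tree_rev.two_group_mono_pair_levels[OF N \<chi> A]) auto
    then show False using avoid by simp
  qed
qed

section \<open>The complete graph\<close>

lemma card_Pow_superset:
  assumes "finite E" "T \<subseteq> E"
  shows "card {R \<in> Pow E. T \<subseteq> R} = 2 ^ (card E - card T)"
    and "card {R \<in> Pow E. T \<inter> R = {}} = 2 ^ (card E - card T)"
proof -
  have fin: "finite (E - T)" "finite T" using assms finite_subset by auto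
  have c: "card (Pow (E - T)) = 2 ^ (card E - card T)"
    using assms fin by (simp add: card_Pow card_Diff_subset)
  have "bij_betw (\<lambda>R. R \<union> T) (Pow (E - T)) {R \<in> Pow E. T \<subseteq> R}"
    by (rule bij_betw_byWitness[where f' = "\<lambda>R. R - T"]) (use assms in auto)
  then show "card {R \<in> Pow E. T \<subseteq> R} = 2 ^ (card E - card T)"
    using c by (simp add: bij_betw_same_card)
  have "{R \<in> Pow E. T \<inter> R = {}} = Pow (E - T)" using assms by auto
  then show "card {R \<in> Pow E. T \<inter> R = {}} = 2 ^ (card E - card T)"
    using c by simp
qed

text \<open>The union bound over \<open>n\<close>-sets, counting edge sets \<open>R\<close> instead
  of drawing one at random. A bad \<open>R\<close> contains all or none of the
  \<open>n choose 2\<close> edges inside \<open>S\<close>, hence the factor 2.\<close>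

lemma erdos_lower_bound:
  assumes less: "N ^ n * 2 < (2 :: nat) ^ (n choose 2)" and n: "n \<le> N"
  obtains \<chi> :: "nat set \<Rightarrow> nat" where "\<chi> \<in> [{..<N}]\<^bsup>2\<^esup> \<rightarrow> {..<2}"
    "\<And>S c. S \<in> [{..<N}]\<^bsup>n\<^esup> \<Longrightarrow> \<exists>e\<in>[S]\<^bsup>2\<^esup>. \<chi> e \<noteq> c"
proof -
  let ?E = "[{..<N}]\<^bsup>2\<^esup>" and ?K = "[{..<N}]\<^bsup>n\<^esup>"
  define bad where "bad S = {R \<in> Pow ?E. [S]\<^bsup>2\<^esup> \<subseteq> R} \<union> {R \<in> Pow ?E. [S]\<^bsup>2\<^esup> \<inter> R = {}}" for S
  have finE: "finite ?E" and finK: "finite ?K" by (simp_all add: finite_imp_finite_nsets)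
  have le: "n choose 2 \<le> card ?E"
    using card_mono[OF finE nsets_mono[of "{..<n}" "{..<N}" 2]] n by simp
  have bad: "card (bad S) \<le> 2 * 2 ^ (card ?E - (n choose 2))" if "S \<in> ?K" for S
  proof -
    have S: "[S]\<^bsup>2\<^esup> \<subseteq> ?E" "card ([S]\<^bsup>2\<^esup>) = n choose 2"
    proof -
      have "S \<subseteq> {..<N}" "card S = n" using that by (auto simp: nsets_def)
      then show "[S]\<^bsup>2\<^esup> \<subseteq> ?E" "card ([S]\<^bsup>2\<^esup>) = n choose 2" by (simp_all add: nsets_mono)
    qed
    show ?thesis
      unfolding bad_def
      using card_Un_le[of "{R \<in> Pow ?E. [S]\<^bsup>2\<^esup> \<subseteq> R}" "{R \<in> Pow ?E. [S]\<^bsup>2\<^esup> \<inter> R = {}}"]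
      unfolding card_Pow_superset[OF finE S(1)] S(2) by linarith
  qed
  have "card (\<Union>S\<in>?K. bad S) \<le> (\<Sum>S\<in>?K. card (bad S))" by (rule card_UN_le[OF finK])
  also have "\<dots> \<le> card ?K * (2 * 2 ^ (card ?E - (n choose 2)))"
    using sum_bounded_above[of ?K "\<lambda>S. card (bad S)", OF bad] by simp
  also have "\<dots> \<le> N ^ n * 2 * 2 ^ (card ?E - (n choose 2))"
    using binomial_le_pow[OF n] by simp
  also have "\<dots> < 2 ^ (n choose 2) * 2 ^ (card ?E - (n choose 2))"
    using less by (intro mult_strict_right_mono) auto
  also have "\<dots> = card (Pow ?E)"
    using le finE by (simp add: card_Pow flip: power_add)
  finally have "card (\<Union>S\<in>?K. bad S) < card (Pow ?E)" .
  moreover have "finite (\<Union>S\<in>?K. bad S)"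
    using finK finE by (auto simp: bad_def)
  ultimately have "\<not> Pow ?E \<subseteq> (\<Union>S\<in>?K. bad S)"
    using card_mono by (metis not_le)
  then obtain R where R: "R \<subseteq> ?E" "\<And>S. S \<in> ?K \<Longrightarrow> R \<notin> bad S" by blast
  show thesis
  proof (rule that[of "\<lambda>e. if e \<in> R then 1 else 0"])
    fix S and c :: nat assume S: "S \<in> ?K"
    then obtain e e' where "e \<in> [S]\<^bsup>2\<^esup>" "e \<notin> R" "e' \<in> [S]\<^bsup>2\<^esup>" "e' \<in> R"
      using R unfolding bad_def by blast
    then show "\<exists>e\<in>[S]\<^bsup>2\<^esup>. (if e \<in> R then 1 else 0) \<noteq> c"
      by (cases "c = 0") force+
  qed auto
qed

lemma step_two:
  assumes "p \<ge> 1"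
  obtains \<chi> where "\<chi> \<in> [{..<2 ^ p}]\<^bsup>2\<^esup> \<rightarrow> {..<2}" "\<not> two_group_mono 2 (4 * p) 1 (2 ^ p) \<chi>"
proof (cases "4 * p \<le> 2 ^ p")
  case True
  have "(2 ^ p) ^ (4 * p) * 2 = (2 :: nat) ^ (4 * p * p + 1)"
    by (simp add: power_mult[symmetric] ac_simps)
  \<comment> \<open>With \<open>a * p\<close> vertices the exponents grow like
    \<open>a * p ^ 2\<close> and \<open>a ^ 2 * p ^ 2 / 2\<close>, so \<open>a\<close> must exceed
    2; \<open>a = 4\<close> works from \<open>p = 1\<close> on.\<close>
  also have "\<dots> < 2 ^ (4 * p choose 2)"
  proof (rule power_strict_increasing)
    have "4 * p choose 2 = 2 * p * (4 * p - 1)" by (simp add: choose_two)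
    moreover obtain q where "p = Suc q" using assms by (cases p) auto
    ultimately show "4 * p * p + 1 < 4 * p choose 2" by (simp add: algebra_simps)
  qed simp
  finally obtain \<chi> :: "nat set \<Rightarrow> nat" where \<chi>: "\<chi> \<in> [{..<2 ^ p}]\<^bsup>2\<^esup> \<rightarrow> {..<2}"
    "\<And>S c. S \<in> [{..<2 ^ p}]\<^bsup>(4 * p)\<^esup> \<Longrightarrow> \<exists>e\<in>[S]\<^bsup>2\<^esup>. \<chi> e \<noteq> c"
    by (rule erdos_lower_bound[OF _ True]) (rule that)
  have "\<not> two_group_mono 2 (4 * p) 1 (2 ^ p) \<chi>"
  proof
    assume "two_group_mono 2 (4 * p) 1 (2 ^ p) \<chi>"
    then obtain A c where A: "\<And>i. i < 4 * p \<Longrightarrow> A i \<in> [{..<2 ^ p}]\<^bsup>1\<^esup>"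
      and pair: "\<And>i j. i < 4 * p \<Longrightarrow> j < 4 * p \<Longrightarrow> i \<noteq> j \<Longrightarrow> A i \<inter> A j = {} \<and>
        (\<forall>e\<in>[A i \<union> A j]\<^bsup>2\<^esup>. \<chi> e = c)"
      by (rule two_group_monoE) blast
    have "\<exists>x. A i = {x} \<and> x < 2 ^ p" if "i < 4 * p" for i
      using A[OF that] by (auto simp: nsets_one)
    then obtain x where x: "\<And>i. i < 4 * p \<Longrightarrow> A i = {x i} \<and> x i < 2 ^ p" by metis
    have inj: "inj_on x {..<4 * p}"
    proof (rule inj_onI)
      fix i j assume "i \<in> {..<4 * p}" "j \<in> {..<4 * p}" "x i = x j"
      then show "i = j" using pair[of i j] x[of i] x[of j] by auto
    qed
    then have "x ` {..<4 * p} \<in> [{..<2 ^ p}]\<^bsup>(4 * p)\<^esup>"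
      using x by (auto simp: nsets_def card_image)
    then obtain e where "e \<in> [x ` {..<4 * p}]\<^bsup>2\<^esup>" "\<chi> e \<noteq> c" using \<chi>(2) by blast
    then obtain i j where "i < 4 * p" "j < 4 * p" "x i \<noteq> x j" "\<chi> {x i, x j} \<noteq> c"
      by (auto elim!: nsets2_E)
    then show False using pair[of i j] x[of i] x[of j] by (auto simp: insert_commute)
  qed
  then show thesis using \<chi>(1) that by blast
next
  case False
  \<comment> \<open>There are more groups than vertices, so any coloring will do.\<close>
  have "\<not> two_group_mono 2 (4 * p) 1 (2 ^ p) (\<lambda>_. 0)"
  proof
    assume "two_group_mono 2 (4 * p) 1 (2 ^ p) (\<lambda>_. 0)"
    then obtain A :: "nat \<Rightarrow> nat set" where A: "\<And>i. i < 4 * p \<Longrightarrow> A i \<in> [{..<2 ^ p}]\<^bsup>1\<^esup>"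
      and pair: "\<And>i j. i < 4 * p \<Longrightarrow> j < 4 * p \<Longrightarrow> i \<noteq> j \<Longrightarrow> A i \<inter> A j = {}"
      by (rule two_group_monoE) blast
    have "card (\<Union>i\<in>{..<4 * p}. A i) = (\<Sum>i\<in>{..<4 * p}. card (A i))"
      using A pair by (intro card_UN_disjoint) (auto simp: nsets_def)
    also have "\<dots> = 4 * p" using A by (simp add: nsets_def)
    finally have "4 * p \<le> card {..<(2 :: nat) ^ p}"
      using A by (metis (no_types, lifting) UN_least card_mono finite_lessThan lessThan_iff mem_Collect_eq nsets_def)
    then show False using False by simp
  qed
  then show thesis using that[of "\<lambda>_. 0"] by auto
qed

section \<open>Iterating the steps\<close>

lemma tower_Suc: "k \<ge> 1 \<Longrightarrow> tower (Suc k) x = 2 powr tower k x"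
  by (cases k) auto

lemma tower_mono: "k \<ge> 1 \<Longrightarrow> x \<le> y \<Longrightarrow> tower k x \<le> tower k y"
  by (induction k rule: nat_induct_at_least) (auto simp: tower_Suc)

text \<open>\<open>r\<close> is 4 for graphs and triples and doubles with each later step.
  \<open>k \<le> 2 * g\<close> and \<open>r \<ge> 2\<close> ensure later that every vertex of a
  group lies in an edge.\<close>

lemma good_coloring:
  assumes "k \<ge> 2"
  obtains g r where "k \<le> 2 * g" "r \<ge> 2"
    "\<And>p. p \<ge> 1 \<Longrightarrow> \<exists>N f. real N = tower k (real p) \<and> f \<in> [{..<N}]\<^bsup>k\<^esup> \<rightarrow> {..<4} \<and>
       \<not> two_group_mono k (r * p) g N f"
proof -
  have two: "\<exists>f. f \<in> [{..<2 ^ p}]\<^bsup>2\<^esup> \<rightarrow> {..<2} \<and> \<not> two_group_mono 2 (4 * p) 1 (2 ^ p) f"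
    if "p \<ge> 1" for p
    using step_two[OF that] by blast
  \<comment> \<open>Graphs are kept apart: the triple step needs their coloring with two colors
    only, and \<open>step_up\<close> starts at uniformity 3.\<close>
  have three: "\<exists>g r. k \<le> 2 * g \<and> r \<ge> 2 \<and> (\<forall>p\<ge>1. \<exists>N f. real N = tower k (real p) \<and>
      f \<in> [{..<N}]\<^bsup>k\<^esup> \<rightarrow> {..<4} \<and> \<not> two_group_mono k (r * p) g N f)" if "k \<ge> 3"
    using that
  proof (induction k rule: nat_induct_at_least)
    case base
    have "\<exists>N f. real N = tower 3 (real p) \<and> f \<in> [{..<N}]\<^bsup>3\<^esup> \<rightarrow> {..<4} \<and>
        \<not> two_group_mono 3 (4 * p) 2 N f" if p: "p \<ge> 1" for p
    proof -
      obtain \<chi> where \<chi>: "\<chi> \<in> [{..<2 ^ p}]\<^bsup>2\<^esup> \<rightarrow> {..<2}" "\<not> two_group_mono 2 (4 * p) 1 (2 ^ p) \<chi>"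
        using two[OF p] by blast
      have "real (2 ^ 2 ^ p) = tower 3 (real p)"
        by (simp add: numeral_3_eq_3 powr_realpow[symmetric])
      moreover have "triple_color \<chi> \<in> [{..<2 ^ 2 ^ p}]\<^bsup>3\<^esup> \<rightarrow> {..<4}"
      proof
        fix e
        have "\<chi> (levels branch e) mod 2 < 2" by simp
        then show "triple_color \<chi> e \<in> {..<4}" unfolding triple_color_def by auto
      qed
      ultimately show ?thesis using step_three[OF \<chi>] by blast
    qed
    then show ?case by (intro exI[of _ 2] exI[of _ 4]) auto
  next
    case (Suc k)
    then obtain g r where gr: "r \<ge> 2" "\<And>p. p \<ge> 1 \<Longrightarrow> \<exists>N f. real N = tower k (real p) \<and>
        f \<in> [{..<N}]\<^bsup>k\<^esup> \<rightarrow> {..<4} \<and> \<not> two_group_mono k (r * p) g N f"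
      by blast
    obtain G where G: "G \<ge> k"
      "\<And>n N \<chi>. \<chi> \<in> [{..<N}]\<^bsup>k\<^esup> \<rightarrow> {..<4} \<Longrightarrow> \<not> two_group_mono k n g N \<chi> \<Longrightarrow>
        \<not> two_group_mono (Suc k) (2 * n) G (2 ^ N) (step_color (<) branch \<chi>)"
      using step_up[OF Suc.hyps, of g] by blast
    have "\<exists>N f. real N = tower (Suc k) (real p) \<and> f \<in> [{..<N}]\<^bsup>Suc k\<^esup> \<rightarrow> {..<4} \<and>
        \<not> two_group_mono (Suc k) (2 * r * p) G N f" if p: "p \<ge> 1" for p
    proof -
      obtain N f where f: "real N = tower k (real p)" "f \<in> [{..<N}]\<^bsup>k\<^esup> \<rightarrow> {..<4}"
        "\<not> two_group_mono k (r * p) g N f"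
        using gr(2)[OF p] by blast
      have "real (2 ^ N) = tower (Suc k) (real p)"
        using Suc.hyps f(1) by (simp add: tower_Suc powr_realpow[symmetric])
      moreover have "step_color (<) branch f \<in> [{..<2 ^ N}]\<^bsup>Suc k\<^esup> \<rightarrow> {..<4}"
        using step_color_less by blast
      moreover have "\<not> two_group_mono (Suc k) (2 * r * p) G (2 ^ N) (step_color (<) branch f)"
        using G(2)[OF f(2,3)] by (simp add: mult.assoc)
      ultimately show ?thesis by blast
    qed
    then show ?case
      using G(1) gr(1) Suc.hyps by (intro exI[of _ G] exI[of _ "2 * r"]) auto
  qed
  show thesis
  proof (cases "k = 2")
    case True
    have "\<exists>N f. real N = tower k (real p) \<and> f \<in> [{..<N}]\<^bsup>k\<^esup> \<rightarrow> {..<4} \<and>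
        \<not> two_group_mono k (4 * p) 1 N f" if p: "p \<ge> 1" for p
    proof -
      obtain \<chi> where \<chi>: "\<chi> \<in> [{..<2 ^ p}]\<^bsup>2\<^esup> \<rightarrow> {..<2}" "\<not> two_group_mono 2 (4 * p) 1 (2 ^ p) \<chi>"
        using two[OF p] by blast
      have "real (2 ^ p) = tower k (real p)"
        using True by (simp add: numeral_2_eq_2 powr_realpow[symmetric])
      moreover have "\<chi> \<in> [{..<2 ^ p}]\<^bsup>k\<^esup> \<rightarrow> {..<4}" using \<chi>(1) True by force
      ultimately show ?thesis using \<chi>(2) True by blast
    qed
    then show thesis using True by (intro that[of 1 4]) auto
  next
    case False
    then have "k \<ge> 3" using assms by simp
    then show thesis using three that by blast
  qed
qed

section \<open>The hypergraph\<close>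

definition group :: "nat \<Rightarrow> nat \<Rightarrow> nat set" where
  "group g i = {i * g..<Suc i * g}"

definition two_group_edges :: "nat \<Rightarrow> nat \<Rightarrow> nat \<Rightarrow> nat set set" where
  "two_group_edges k n g =
     (\<Union>i<n. \<Union>j\<in>{..<n} - {i}. [group g i \<union> group g j]\<^bsup>k\<^esup>)"

lemma card_group: "card (group g i) = g"
  by (simp add: group_def)

lemma group_disjoint:
  assumes "i \<noteq> j"
  shows "group g i \<inter> group g j = {}"
proof -
  have *: "group g i \<inter> group g j = {}" if "i < j" for i j
  proof -
    have "Suc i * g \<le> j * g" using that by (intro mult_le_mono1) simp
    then show ?thesis by (auto simp: group_def)
  qed
  show ?thesis using *[of i j] *[of j i] assms by (cases i j rule: linorder_cases) auto
qed

lemma group_subset: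
  assumes "i < n"
  shows "group g i \<subseteq> {..<n * g}"
proof -
  have "Suc i * g \<le> n * g" using assms by (intro mult_le_mono1) simp
  then show ?thesis by (auto simp: group_def)
qed

lemma two_group_edges_subset: "two_group_edges k n g \<subseteq> [{..<n * g}]\<^bsup>k\<^esup>"
  unfolding two_group_edges_def
  by (intro UN_least nsets_mono Un_least group_subset) auto

text \<open>Edges inside one group are counted for every partner; only the quadratic growth in
  \<open>n\<close> matters.\<close>

lemma card_two_group_edges: "card (two_group_edges k n g) \<le> n * n * (2 * g choose k)"
proof -
  have le: "card ([group g i \<union> group g j]\<^bsup>k\<^esup>) \<le> 2 * g choose k" if "j \<in> {..<n} - {i}" for i j
    using that group_disjoint[of i j g] card_group
    by (simp add: card_Un_disjoint group_def mult_2)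
  have "card (\<Union>j\<in>{..<n} - {i}. [group g i \<union> group g j]\<^bsup>k\<^esup>) \<le> n * (2 * g choose k)" for i
  proof -
    have "card (\<Union>j\<in>{..<n} - {i}. [group g i \<union> group g j]\<^bsup>k\<^esup>)
        \<le> (\<Sum>j\<in>{..<n} - {i}. card ([group g i \<union> group g j]\<^bsup>k\<^esup>))"
      by (rule card_UN_le) simp
    also have "\<dots> \<le> of_nat (card ({..<n} - {i})) * (2 * g choose k)"
      by (rule sum_bounded_above) (rule le)
    also have "\<dots> \<le> n * (2 * g choose k)"
      using card_mono[of "{..<n}" "{..<n} - {i}"] by simp
    finally show ?thesis .
  qed
  then have "(\<Sum>i<n. card (\<Union>j\<in>{..<n} - {i}. [group g i \<union> group g j]\<^bsup>k\<^esup>))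
      \<le> of_nat (card {..<n}) * (n * (2 * g choose k))"
    by (intro sum_bounded_above)
  moreover have "card (two_group_edges k n g)
      \<le> (\<Sum>i<n. card (\<Union>j\<in>{..<n} - {i}. [group g i \<union> group g j]\<^bsup>k\<^esup>))"
    unfolding two_group_edges_def by (rule card_UN_le) simp
  ultimately show ?thesis by (simp add: mult.assoc)
qed

text \<open>The vertex set will be the union of the edges, so an embedding is defined on whole
  groups only if each of their vertices lies in an edge.\<close>

lemma group_subset_Union_edges:
  assumes "n \<ge> 2" "1 \<le> k" "k \<le> 2 * g" "i < n"
  shows "group g i \<subseteq> \<Union> (two_group_edges k n g)"
proof
  fix v assume v: "v \<in> group g i"
  define j where "j = (if i = 0 then 1 else 0 :: nat)"
  have j: "j < n" "j \<noteq> i" using assms by (auto simp: j_def)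
  let ?U = "group g i \<union> group g j"
  have fin: "finite ?U" by (simp add: group_def)
  have "card ?U = 2 * g"
    using group_disjoint[OF j(2)[symmetric]] card_group by (simp add: card_Un_disjoint group_def)
  then have "k - 1 \<le> card (?U - {v})" using assms v by simp
  then obtain e where e: "e \<subseteq> ?U - {v}" "card e = k - 1" "finite e"
    by (rule obtain_subset_with_card_n)
  then have "insert v e \<in> [?U]\<^bsup>k\<^esup>" using v assms(2) by (auto simp: nsets_def card_insert_if)
  then have "insert v e \<in> two_group_edges k n g"
    unfolding two_group_edges_def using assms(4) j by blast
  then show "v \<in> \<Union> (two_group_edges k n g)" by blast
qed

text \<open>Taking the union of the edges as vertex set excludes isolated vertices by construction.
  The added blocks lie beyond \<open>s\<close>, so they are new edges.\<close>

lemma extend_by_matching: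
  fixes E0 :: "nat set set"
  assumes k: "k \<ge> 1" and E0: "E0 \<subseteq> [{..<s}]\<^bsup>k\<^esup>" "card E0 \<le> m"
  obtains E where "E0 \<subseteq> E" "card E = m" "uniform_hypergraph k (\<Union>E) E"
    "\<nexists>v. isolated_vertex (\<Union>E) E v"
proof -
  define M where "M t = {s + t * k..<s + Suc t * k}" for t
  have fin0: "finite E0" using E0(1) finite_subset finite_imp_finite_nsets by blast
  have inj: "inj M" unfolding M_def inj_def using k by (auto simp: atLeastLessThan_eq_iff)
  have cM: "card (M t) = k" for t by (simp add: M_def)
  have disj: "E0 \<inter> M ` {..<m - card E0} = {}"
  proof -
    have "M t \<notin> E0" for t
    proof
      assume "M t \<in> E0"
      then have "M t \<subseteq> {..<s}" using E0(1) by (auto simp: nsets_def)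
      moreover have "s + t * k \<in> M t" using k by (simp add: M_def)
      ultimately show False by auto
    qed
    then show ?thesis by auto
  qed
  let ?E = "E0 \<union> M ` {..<m - card E0}"
  have edge: "finite e \<and> card e = k" if "e \<in> ?E" for e
    using that E0(1) cM by (auto simp: nsets_def M_def)
  have finE: "finite ?E" using fin0 by simp
  show thesis
  proof (rule that[of ?E])
    have "card (M ` {..<m - card E0}) = m - card E0"
      using inj by (simp add: card_image inj_on_subset)
    then show "card ?E = m" using E0(2) fin0 disj by (simp add: card_Un_disjoint)
    show "uniform_hypergraph k (\<Union>?E) ?E"
      unfolding uniform_hypergraph_def nsets_def using finE edge by auto
    show "\<nexists>v. isolated_vertex (\<Union>?E) ?E v" unfolding isolated_vertex_def by blast
  qed simp
qed

section \<open>Ramsey numbers\<close>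

text \<open>Ramsey's theorem for a clique on \<open>card V\<close> vertices; it guarantees that the
  \<open>LEAST\<close> in \<open>ramsey_number\<close> is attained.\<close>

lemma ramsey_arrow_exists:
  assumes "uniform_hypergraph k V E"
  shows "\<exists>N. ramsey_arrow k V E q N"
proof -
  obtain N :: nat where N: "partn_lst {..<N} (replicate q (card V)) k" using ramsey_full by blast
  have "ramsey_arrow k V E q N"
    unfolding ramsey_arrow_def
  proof
    fix f :: "nat set \<Rightarrow> nat" assume "f \<in> [{..<N}]\<^bsup>k\<^esup> \<rightarrow> {..<q}"
    with N obtain i H where i: "i < length (replicate q (card V))"
      and H: "H \<in> [{..<N}]\<^bsup>(replicate q (card V) ! i)\<^esup>" "f ` [H]\<^bsup>k\<^esup> \<subseteq> {i}"
      by (rule partn_lstE) simp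
    then have i: "i < q" and H': "H \<subseteq> {..<N}" "finite H" "card H = card V" by (auto simp: nsets_def)
    have V: "finite V" "E \<subseteq> [V]\<^bsup>k\<^esup>" using assms by (auto simp: uniform_hypergraph_def)
    then obtain \<phi> where \<phi>: "bij_betw \<phi> V H" using H' finite_same_card_bij by metis
    have "\<phi> ` e \<in> [H]\<^bsup>k\<^esup>" if "e \<in> E" for e
      using bij_betw_nsets[OF \<phi>] V that by (auto simp: bij_betw_def)
    then have "\<phi> ` e \<in> {e \<in> [{..<N}]\<^bsup>k\<^esup>. f e = i}" if "e \<in> E" for e
      using H(2) nsets_mono[OF H'(1)] that by blast
    then have "contains_copy V E {..<N} {e \<in> [{..<N}]\<^bsup>k\<^esup>. f e = i}"
      unfolding contains_copy_def using \<phi> H'(1) by (auto simp: bij_betw_def)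
    then show "\<exists>i<q. contains_copy V E {..<N} {e \<in> [{..<N}]\<^bsup>k\<^esup>. f e = i}" using i by blast
  qed
  then show ?thesis by blast
qed

lemma ramsey_arrow_ramsey_number:
  "uniform_hypergraph k V E \<Longrightarrow> ramsey_arrow k V E q (ramsey_number k V E q)"
  unfolding ramsey_number_def using ramsey_arrow_exists by (rule LeastI_ex)

text \<open>Injectivity of the embedding is enough for this bound, which settles small
  \<open>m\<close>.\<close>

lemma card_le_ramsey_number:
  assumes "uniform_hypergraph k V E" "q \<ge> 1"
  shows "card V \<le> ramsey_number k V E q"
proof -
  let ?N = "ramsey_number k V E q"
  have "(\<lambda>_. 0) \<in> [{..<?N}]\<^bsup>k\<^esup> \<rightarrow> {..<q}" using assms(2) by auto
  then obtain \<phi> where "inj_on \<phi> V" "\<phi> ` V \<subseteq> {..<?N}"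
    using ramsey_arrow_ramsey_number[OF assms(1), of q]
    unfolding ramsey_arrow_def contains_copy_def by metis
  then show ?thesis using card_inj_on_le[of \<phi> V "{..<?N}"] by simp
qed

text \<open>A Ramsey number of at most \<open>N\<close> would yield a copy in the restriction of
  \<open>f\<close>, and the images of the groups contradict \<open>avoid\<close>.\<close>

lemma ramsey_number_gt:
  assumes H: "uniform_hypergraph k V E" and E: "two_group_edges k n g \<subseteq> E"
    and V: "\<And>i. i < n \<Longrightarrow> group g i \<subseteq> V"
    and f: "f \<in> [{..<N}]\<^bsup>k\<^esup> \<rightarrow> {..<q}" and avoid: "\<not> two_group_mono k n g N f"
  shows "N < ramsey_number k V E q"
proof (rule ccontr)
  let ?R = "ramsey_number k V E q"
  assume "\<not> N < ?R"
  then have sub: "{..<?R} \<subseteq> {..<N}" by auto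
  have "f \<in> [{..<?R}]\<^bsup>k\<^esup> \<rightarrow> {..<q}" using f nsets_mono[OF sub] by (auto simp: Pi_iff)
  then obtain i where "contains_copy V E {..<?R} {e \<in> [{..<?R}]\<^bsup>k\<^esup>. f e = i}"
    using ramsey_arrow_ramsey_number[OF H, of q] unfolding ramsey_arrow_def by blast
  then obtain \<phi> where \<phi>: "inj_on \<phi> V" "\<phi> ` V \<subseteq> {..<?R}" "\<And>e. e \<in> E \<Longrightarrow> f (\<phi> ` e) = i"
    unfolding contains_copy_def by (elim exE conjE) auto
  have "two_group_mono k n g N f"
    unfolding two_group_mono_def
  proof (intro exI[of _ "\<lambda>j. \<phi> ` group g j"] exI[of _ i] conjI allI impI ballI)
    fix j assume j: "j < n"
    have "\<phi> ` group g j \<subseteq> {..<N}" 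
      using image_mono[OF V[OF j], of \<phi>] \<phi>(2) sub by (meson subset_trans)
    moreover have "card (\<phi> ` group g j) = g"
      using card_image[OF inj_on_subset[OF \<phi>(1) V[OF j]]] card_group by simp
    moreover have "finite (\<phi> ` group g j)" by (simp add: group_def)
    ultimately show "\<phi> ` group g j \<in> [{..<N}]\<^bsup>g\<^esup>" by (simp add: nsets_def)
  next
    fix j l assume jl: "j < n" "l < n" "j \<noteq> l"
    show "\<phi> ` group g j \<inter> \<phi> ` group g l = {}"
      using inj_on_image_Int[OF \<phi>(1) V[OF jl(1)] V[OF jl(2)]] group_disjoint[OF jl(3)] by auto
    fix e assume "e \<in> [\<phi> ` group g j \<union> \<phi> ` group g l]\<^bsup>k\<^esup>"
    then have e: "e \<in> [\<phi> ` (group g j \<union> group g l)]\<^bsup>k\<^esup>" by (simp add: image_Un)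
    have "inj_on \<phi> (group g j \<union> group g l)"
      using inj_on_subset[OF \<phi>(1)] V[OF jl(1)] V[OF jl(2)] by blast
    with e obtain e' where e': "e' \<in> [group g j \<union> group g l]\<^bsup>k\<^esup>" "e = \<phi> ` e'"
      by (rule nset_image_obtains)
    then have "e' \<in> E" using E jl unfolding two_group_edges_def by auto
    then show "f e = i" using \<phi>(3) e' by simp
  qed
  then show False using avoid by simp
qed

theorem theorem1p3:
  fixes k :: nat
  assumes "k \<ge> 2"
  shows "\<exists>c::real. c > 0 \<and> (\<forall>m::nat. m > 0 \<longrightarrow> (k \<ge> 4 \<longrightarrow> c * sqrt (real m) \<ge> 1) \<longrightarrow>
           (\<exists>(V :: nat set) E. uniform_hypergraph k V E \<and> card E = m \<and>
              (\<nexists>v. isolated_vertex V E v) \<and>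
              real (ramsey_number k V E 4) \<ge> tower k (c * sqrt (real m))))"
proof -
  obtain g r where gr: "k \<le> 2 * g" "r \<ge> 2"
    "\<And>p. p \<ge> 1 \<Longrightarrow> \<exists>N f. real N = tower k (real p) \<and> f \<in> [{..<N}]\<^bsup>k\<^esup> \<rightarrow> {..<4} \<and>
       \<not> two_group_mono k (r * p) g N f"
    using good_coloring[OF assms] by metis
  \<comment> \<open>With \<open>r * p\<close> groups there are at most \<open>C * p ^ 2\<close>
    edges.\<close>
  define C where "C = r * r * (2 * g choose k)"
  have "C > 0" using gr by (simp add: C_def)
  \<comment> \<open>The factor 2 pays for rounding \<open>sqrt (m / C)\<close> down to an
    integer.\<close>
  define c where "c = 1 / (2 * sqrt (real C))"
  have "c > 0" using \<open>C > 0\<close> by (simp add: c_def)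
  moreover have "\<exists>(V :: nat set) E. uniform_hypergraph k V E \<and> card E = m \<and>
      (\<nexists>v. isolated_vertex V E v) \<and> real (ramsey_number k V E 4) \<ge> tower k (c * sqrt (real m))"
    if m: "m > 0" and big: "k \<ge> 4 \<longrightarrow> c * sqrt (real m) \<ge> 1" for m
  proof -
    define x where "x = sqrt (real m / real C)"
    have cx: "c * sqrt (real m) = x / 2" by (simp add: c_def x_def real_sqrt_divide)
    have "x \<ge> 0" by (simp add: x_def)
    show ?thesis
    proof (cases "x \<ge> 1")
      case True
      \<comment> \<open>The largest \<open>p\<close> with \<open>C * p ^ 2 \<le> m\<close>.\<close>
      define p where "p = nat \<lfloor>x\<rfloor>"
      have p: "p \<ge> 1" "real p \<le> x" "x / 2 \<le> real p"
      proof -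
        have "1 \<le> \<lfloor>x\<rfloor>" using True by (simp add: le_floor_iff)
        moreover from this have "real p = of_int \<lfloor>x\<rfloor>" by (simp add: p_def)
        ultimately show "p \<ge> 1" "real p \<le> x" "x / 2 \<le> real p" by linarith+
      qed
      have "(real p)\<^sup>2 \<le> x\<^sup>2" using p by (intro power_mono) auto
      also have "x\<^sup>2 = real m / real C" by (simp add: x_def)
      finally have "real (C * p\<^sup>2) \<le> real m" using \<open>C > 0\<close> by (simp add: field_simps)
      then have Cp: "C * p\<^sup>2 \<le> m" by (simp only: of_nat_le_iff)
      obtain N f where f: "real N = tower k (real p)" "f \<in> [{..<N}]\<^bsup>k\<^esup> \<rightarrow> {..<4}"
        "\<not> two_group_mono k (r * p) g N f"
        using gr(3)[OF p(1)] by blast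
      let ?n = "r * p"
      have "?n * ?n * (2 * g choose k) = C * p\<^sup>2" by (simp add: C_def power2_eq_square)
      then have card: "card (two_group_edges k ?n g) \<le> m"
        using card_two_group_edges[of k ?n g] Cp by simp
      have k1: "1 \<le> k" using assms by simp
      have n2: "?n \<ge> 2" using gr(2) p(1) mult_le_mono[of 2 r 1 p] by simp
      obtain E where E: "two_group_edges k ?n g \<subseteq> E" "card E = m"
        "uniform_hypergraph k (\<Union>E) E" "\<nexists>v. isolated_vertex (\<Union>E) E v"
        using extend_by_matching[OF k1 two_group_edges_subset card] by blast
      have "group g i \<subseteq> \<Union>E" if "i < ?n" for i
        using group_subset_Union_edges[OF n2 k1 gr(1) that] E(1) by blast
      then have "N < ramsey_number k (\<Union>E) E 4"
        using ramsey_number_gt[OF E(3,1) _ f(2,3)] by blast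
      moreover have "tower k (c * sqrt (real m)) \<le> real N"
        unfolding f(1) cx using tower_mono[OF k1 p(3)] .
      ultimately have "tower k (c * sqrt (real m)) \<le> real (ramsey_number k (\<Union>E) E 4)" by linarith
      then show ?thesis using E by blast
    next
      case False
      \<comment> \<open>Now \<open>c * sqrt m\<close> is below 1/2, which is possible only for
        \<open>k < 4\<close>. Any hypergraph with \<open>m\<close> edges works, as one edge already
        gives \<open>k\<close> vertices.\<close>
      then have k: "k = 2 \<or> k = 3" using big cx assms by auto
      obtain E :: "nat set set" where E: "card E = m"
        "uniform_hypergraph k (\<Union>E) E" "\<nexists>v. isolated_vertex (\<Union>E) E v"
        using extend_by_matching[of k "{}" 0 m] assms by auto
      then obtain e where "e \<in> E" using m by fastforce
      moreover have "finite (\<Union>E)" using E(2) by (simp add: uniform_hypergraph_def)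
      ultimately have "k \<le> card (\<Union>E)"
        using E(2) card_mono[of "\<Union>E" e] by (auto simp: uniform_hypergraph_def nsets_def)
      also have "\<dots> \<le> ramsey_number k (\<Union>E) E 4" using card_le_ramsey_number[OF E(2)] by simp
      finally have "real k \<le> real (ramsey_number k (\<Union>E) E 4)" by simp
      moreover have "tower k (c * sqrt (real m)) \<le> tower k (1 / 2)"
        using False assms by (intro tower_mono) (auto simp: cx)
      moreover have "tower k (1 / 2) \<le> real k"
      proof -
        \<comment> \<open>This bound on the square root of 2 serves twice, once inside the
          exponent.\<close>
        have s: "2 powr (1 / 2) \<le> (3 / 2 :: real)"
          unfolding powr_half_sqrt[OF zero_le_numeral] by (rule real_le_lsqrt) (simp_all add: power2_eq_square)
        have "2 powr (2 powr (1 / 2)) \<le> (2 :: real) powr (1 + 1 / 2)"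
          using s by (intro powr_mono) linarith+
        also have "\<dots> = 2 * 2 powr (1 / 2)" unfolding powr_add by simp
        also have "\<dots> \<le> 3" using s by linarith
        finally have three: "2 powr (2 powr (1 / 2)) \<le> (3 :: real)" .
        have "tower 2 (1 / 2) = 2 powr (1 / 2)" "tower 3 (1 / 2) = 2 powr (2 powr (1 / 2))"
          by (simp_all only: numeral_2_eq_2 numeral_3_eq_3 tower.simps)
        then show ?thesis using k s three by auto
      qed
      ultimately show ?thesis using E by (intro exI[of _ "\<Union>E"] exI[of _ E]) auto
    qed
  qed
  ultimately show ?thesis by blast
qed

end
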